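(* Let $W$ be a discrete memoryless channel with input alphabet $\mathcal X=\{1,\dots,J\}$ and output alphabet $\mathcal Y=\{1,\dots,K\}$, and let $q:\mathcal X\times\mathcal Y\to\mathbb R$ be a decoding metric. Then $$C_q(W)\le \bar R(W,q):=\max_{P_X}\ \min_{\substack{P_{Y\hat Y|X}\in\mathcal M_{\max}(q,P_X)\\ P_{Y|X}=W}} I(P_X,P_{\hat Y|X}),$$ where the maximum is over probability mass functions $P_X$ on $\mathcal X$, $P_{Y|X}$ and $P_{\hat Y|X}$ denote the two marginal conditional distributions of $P_{Y\hat Y|X}$, and $I(P_X,P_{\hat Y|X})$ is the mutual information between input and output when the input has law $P_X$ and the channel is $P_{\hat Y|X}$.
   Context: A DMC $W$ is a conditional pmf $W(k|j)$ on $\mathcal Y$ given $\mathcal X$, used as $W^n(\mathbf y|\mathbf x)=\prod_{i=1}^n W(y_i|x_i)$. For a codebook $\mathcal C_n=\{\mathbf x_1,\dots,\mathbf x_M\}\subset\mathcal X^n$, a message $m$ is chosen uniformly, $\mathbf x_m$ is sent, and the $q$-decoder outputs $\hat m=\arg\max_{m'} q^n(\mathbf x_{m'},\mathbf y)$ where $q^n(\mathbf x,\mathbf y)=\sum_{i=1}^n q(x_i,y_i)$ (an error occurs whenever some $\bar m\neq m$ has $q^n(\mathbf x_{\bar m},\mathbf y)\ge q^n(\mathbf x_m,\mathbf y)$). $P_e^q(\mathcal C_n,W)$ is the average error probability. A rate $R>0$ is achievable if for every $\epsilon>0$ there is a sequence of codebooks with $|\mathcal C_n|\ge 2^{n(R-\epsilon)}$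 and $\liminf_{n\to\infty} P_e^q(\mathcal C_n,W)=0$; the mismatch capacity $C_q(W)$ is the supremum of achievable rates. For a pmf $P_{X_1}$ on $\mathcal X$, $\mathcal M_{\max}(q,P_{X_1})$ is the set of all conditional pmfs $P_{Y\hat Y|X_1}$ on $\mathcal Y\times\mathcal Y$ given $\mathcal X$ such that, for every conditional pmf $P_{X_2|X_1\hat Y}$ on $\mathcal X$ given $\mathcal X\times\mathcal Y$ for which, under the joint law $P_{X_1}(x_1)P_{Y\hat Y|X_1}(y,\hat y|x_1)P_{X_2|X_1\hat Y}(x_2|x_1,\hat y)$ (so that $X_2-(X_1,\hat Y)-Y$ is a Markov chain), the marginals satisfy $P_{\hat Y X_2}=P_{\hat Y X_1}$, one has $\mathbb E[q(X_2,Y)]\ge \mathbb E[q(X_1,Y)]$. *)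

theory Defs
  imports Complex_Main "HOL-Library.Extended_Real" "HOL-Library.Liminf_Limsup"
begin

(* Input alphabet = finite type 'x, output alphabet = finite type 'y.
   Logarithms are base 2 (rates measured in bits, codebook sizes 2^(nR)). *)

definition is_pmf :: "('a::finite \<Rightarrow> real) \<Rightarrow> bool" where
  "is_pmf P \<longleftrightarrow> (\<forall>a. 0 \<le> P a) \<and> (\<Sum>a\<in>UNIV. P a) = 1"

definition is_channel :: "('a \<Rightarrow> 'b::finite \<Rightarrow> real) \<Rightarrow> bool" where
  "is_channel W \<longleftrightarrow> (\<forall>a. is_pmf (W a))"

definition Wn :: "('x \<Rightarrow> 'y \<Rightarrow> real) \<Rightarrow> nat \<Rightarrow> 'x list \<Rightarrow> 'y list \<Rightarrow> real" where
  "Wn W n xs ys = (\<Prod>i<n. W (xs ! i) (ys ! i))"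

definition qn :: "('x \<Rightarrow> 'y \<Rightarrow> real) \<Rightarrow> nat \<Rightarrow> 'x list \<Rightarrow> 'y list \<Rightarrow> real" where
  "qn q n xs ys = (\<Sum>i<n. q (xs ! i) (ys ! i))"

(* a codebook of block length n: nonempty list of distinct codewords in X^n;
   message m is sent as codeword C ! m, |C_n| = length C *)
definition is_codebook :: "nat \<Rightarrow> 'x list list \<Rightarrow> bool" where
  "is_codebook n C \<longleftrightarrow> C \<noteq> [] \<and> distinct C \<and> (\<forall>c\<in>set C. length c = n)"

(* average error probability of the q-decoder (ties count as errors) *)
definition Pe :: "('x \<Rightarrow> 'y::finite \<Rightarrow> real) \<Rightarrow> ('x \<Rightarrow> 'y \<Rightarrow> real) \<Rightarrow> nat \<Rightarrow> 'x list list \<Rightarrow> real" where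
  "Pe q W n C = (1 / real (length C)) *
     (\<Sum>m<length C. \<Sum>ys\<in>{ys :: 'y list. length ys = n}.
        (if (\<exists>m'<length C. m' \<noteq> m \<and> qn q n (C ! m') ys \<ge> qn q n (C ! m) ys)
         then Wn W n (C ! m) ys else 0))"

definition achievable :: "('x \<Rightarrow> 'y::finite \<Rightarrow> real) \<Rightarrow> ('x \<Rightarrow> 'y \<Rightarrow> real) \<Rightarrow> real \<Rightarrow> bool" where
  "achievable q W R \<longleftrightarrow> R > 0 \<and>
     (\<forall>\<epsilon>>0. \<exists>Cs :: nat \<Rightarrow> 'x list list.
        (\<forall>n. is_codebook n (Cs n) \<and> real (length (Cs n)) \<ge> 2 powr (real n * (R - \<epsilon>)))
        \<and> liminf (\<lambda>n. ereal (Pe q W n (Cs n))) = 0)"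

definition mismatch_capacity :: "('x \<Rightarrow> 'y::finite \<Rightarrow> real) \<Rightarrow> ('x \<Rightarrow> 'y \<Rightarrow> real) \<Rightarrow> ereal" where
  "mismatch_capacity q W = Sup (ereal ` {R. achievable q W R})"

definition mutual_info :: "('x::finite \<Rightarrow> real) \<Rightarrow> ('x \<Rightarrow> 'y::finite \<Rightarrow> real) \<Rightarrow> real" where
  "mutual_info P V = (\<Sum>x\<in>UNIV. \<Sum>y\<in>UNIV.
      (if P x * V x y = 0 then 0
       else P x * V x y * log 2 (V x y / (\<Sum>x'\<in>UNIV. P x' * V x' y))))"

definition is_cond_pmf2 :: "('x \<Rightarrow> 'y::finite \<Rightarrow> 'y \<Rightarrow> real) \<Rightarrow> bool" where
  "is_cond_pmf2 V \<longleftrightarrow> (\<forall>x y yh. 0 \<le> V x y yh) \<and> (\<forall>x. (\<Sum>y\<in>UNIV. \<Sum>yh\<in>UNIV. V x y yh) = 1)"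

(* M_max(q, P): U x1 yh x2 is P_{X2|X1 Yhat} *)
definition Mmax :: "('x::finite \<Rightarrow> 'y::finite \<Rightarrow> real) \<Rightarrow> ('x \<Rightarrow> real) \<Rightarrow> ('x \<Rightarrow> 'y \<Rightarrow> 'y \<Rightarrow> real) set" where
  "Mmax q P = {V. is_cond_pmf2 V \<and>
     (\<forall>U :: 'x \<Rightarrow> 'y \<Rightarrow> 'x \<Rightarrow> real.
        ((\<forall>x1 yh. is_pmf (U x1 yh)) \<and>
         (\<forall>yh x2. (\<Sum>x1\<in>UNIV. \<Sum>y\<in>UNIV. P x1 * V x1 y yh * U x1 yh x2)
                  = (\<Sum>y\<in>UNIV. P x2 * V x2 y yh)))
        \<longrightarrow> (\<Sum>x1\<in>UNIV. \<Sum>y\<in>UNIV. \<Sum>yh\<in>UNIV. \<Sum>x2\<in>UNIV.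
               P x1 * V x1 y yh * U x1 yh x2 * q x2 y)
            \<ge> (\<Sum>x1\<in>UNIV. \<Sum>y\<in>UNIV. \<Sum>yh\<in>UNIV. P x1 * V x1 y yh * q x1 y))}"

definition marg_Y :: "('x \<Rightarrow> 'y::finite \<Rightarrow> 'y \<Rightarrow> real) \<Rightarrow> 'x \<Rightarrow> 'y \<Rightarrow> real" where
  "marg_Y V x y = (\<Sum>yh\<in>UNIV. V x y yh)"

definition marg_Yhat :: "('x \<Rightarrow> 'y::finite \<Rightarrow> 'y \<Rightarrow> real) \<Rightarrow> 'x \<Rightarrow> 'y \<Rightarrow> real" where
  "marg_Yhat V x yh = (\<Sum>y\<in>UNIV. V x y yh)"

definition Rbar :: "('x::finite \<Rightarrow> 'y::finite \<Rightarrow> real) \<Rightarrow> ('x \<Rightarrow> 'y \<Rightarrow> real) \<Rightarrow> real" where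
  "Rbar W q = (SUP P\<in>{P. is_pmf P}.
      INF V\<in>{V. V \<in> Mmax q P \<and> marg_Y V = W}. mutual_info P (marg_Yhat V))"

end

theory Submission
  imports Defs "HOL-Library.Multiset" "HOL-Library.Cardinality" "HOL-Library.FuncSet"
    "HOL-Library.Indicator_Function"
begin

text \<open>
  Let \<open>V\<close> be maximal for a fully supported \<open>P\<close>, with \<open>Y\<close>-marginal \<open>W\<close>, and draw \<open>(Y, Z)\<close> from the
  memoryless extension of \<open>V\<close> when \<open>x\<close> is sent, where \<open>Z\<close> stands for the auxiliary output.

  If another codeword \<open>x'\<close> has the same joint type with \<open>Z\<close> as \<open>x\<close>, then the empirical law of
  \<open>(x, Z, x')\<close> is, for each letter of \<open>Z\<close>, a circulation on the input alphabet. Hence maximality makes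
  the conditional mean of \<open>q(x', Y) - q(x, Y)\<close> given \<open>Z\<close> nonnegative, with no loss from the deviation
  of the type from \<open>P\<close> and \<open>V\<close>. A sum of independent variables taken from finitely many laws
  and with nonnegative mean is nonnegative with probability bounded away from zero (fourth moments),
  so the decoder errs with at least this probability.

  For each \<open>Z\<close> at most polynomially many codewords share their joint type with no other
  codeword. Changing measure to the product output law shows that such an isolated codeword is rarely
  the one sent once the rate exceeds the mutual information between input and \<open>Z\<close>.

  The law \<open>P\<close> is taken from a finite family that dominates the composition of every codeword up to
  a factor \<open>1 + \<eta>\<close>, and some member of it serves a fixed fraction of the codewords.
\<close>

section \<open>Constants over finite types\<close>

lemma finite_type_upper_bound:
  fixes f :: "'a::finite \<Rightarrow> 'b::finite \<Rightarrow> real"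
  obtains B where "0 < B" "\<And>a b. f a b \<le> B"
proof -
  obtain M where "\<And>a b. f a b \<le> M"
    using bdd_above_finite[of "range (\<lambda>(a, b). f a b)"] by (auto simp: bdd_above_def)
  then have "f a b \<le> max 1 M" for a b by (simp add: max.coboundedI2)
  then show thesis using that[of "max 1 M"] by simp
qed

lemma finite_positive_scaling:
  fixes f g :: "'a \<Rightarrow> real"
  assumes "finite A" "\<And>a. a \<in> A \<Longrightarrow> 0 \<le> g a" "\<And>a. a \<in> A \<Longrightarrow> g a = 0 \<Longrightarrow> f a = 0"
  obtains e where "0 < e" "\<And>a. a \<in> A \<Longrightarrow> e * f a \<le> g a"
proof -
  have "\<forall>\<^sub>F e in at_right 0. e * f a \<le> g a" if a: "a \<in> A" for a
  proof (cases "g a = 0")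
    case False
    have "((\<lambda>e. e * f a) \<longlongrightarrow> 0 * f a) (at_right 0)" by (intro tendsto_intros)
    moreover have "0 * f a < g a" using assms(2)[OF a] False by simp
    ultimately show ?thesis by (intro eventually_mono[OF order_tendstoD(2)]) auto
  qed (simp add: assms(3)[OF a])
  then have "\<forall>\<^sub>F e in at_right 0. \<forall>a\<in>A. e * f a \<le> g a"
    using assms(1) by (intro eventually_ball_finite) auto
  then have "\<forall>\<^sub>F e in at_right 0. 0 < e \<and> (\<forall>a\<in>A. e * f a \<le> g a)"
    using eventually_at_right_less[of 0] by eventually_elim simp
  then show thesis using that eventually_happens'[OF trivial_limit_at_right_real] by blast
qed

lemma finite_positive_lower_bound:
  fixes f :: "'a \<Rightarrow> real"
  assumes "finite A" "\<And>a. a \<in> A \<Longrightarrow> 0 < f a"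
  obtains e where "0 < e" "\<And>a. a \<in> A \<Longrightarrow> e \<le> f a"
  using finite_positive_scaling[of A f "\<lambda>_. 1"] assms by (auto simp: less_le)

section \<open>Expectations under memoryless channels\<close>

definition is_channel_on :: "'a set \<Rightarrow> ('a \<Rightarrow> 'y::finite \<Rightarrow> real) \<Rightarrow> bool" where
  "is_channel_on A K \<longleftrightarrow> (\<forall>a\<in>A. is_pmf (K a))"

lemma is_channel_on_insert [simp]:
  "is_channel_on (insert a A) K \<longleftrightarrow> is_pmf (K a) \<and> is_channel_on A K"
  by (simp add: is_channel_on_def)

lemma is_channel_imp_is_channel_on: "is_channel K \<Longrightarrow> is_channel_on A K"
  by (simp add: is_channel_def is_channel_on_def)

lemma is_pmf_imp_is_channel_on: "is_pmf Q \<Longrightarrow> is_channel_on A (\<lambda>_. Q)"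
  by (simp add: is_channel_on_def)

lemma Wn_0 [simp]: "Wn K 0 as ys = 1"
  by (simp add: Wn_def)

lemma Wn_Suc_Cons [simp]: "Wn K (Suc n) (a # as) (y # ys) = K a y * Wn K n as ys"
  by (simp add: Wn_def prod.lessThan_Suc_shift del: prod.lessThan_Suc)

lemma qn_0 [simp]: "qn g 0 as ys = 0"
  by (simp add: qn_def)

lemma qn_Suc_Cons [simp]: "qn g (Suc n) (a # as) (y # ys) = g a y + qn g n as ys"
  by (simp add: qn_def sum.lessThan_Suc_shift del: sum.lessThan_Suc)

lemma Wn_nonneg:
  assumes "is_channel_on (set as) K"
  shows "0 \<le> Wn K (length as) as ys"
  using assms unfolding Wn_def by (intro prod_nonneg) (auto simp: is_channel_on_def is_pmf_def)

definition block_expect :: "('a \<Rightarrow> 'y::finite \<Rightarrow> real) \<Rightarrow> 'a list \<Rightarrow> ('y list \<Rightarrow> real) \<Rightarrow> real" where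
  "block_expect K as F = (\<Sum>ys | length ys = length as. Wn K (length as) as ys * F ys)"

definition block_prob :: "('a \<Rightarrow> 'y::finite \<Rightarrow> real) \<Rightarrow> 'a list \<Rightarrow> 'y list set \<Rightarrow> real" where
  "block_prob K as A = block_expect K as (indicator A)"

definition letter_expect :: "('a \<Rightarrow> 'y::finite \<Rightarrow> real) \<Rightarrow> ('a \<Rightarrow> 'y \<Rightarrow> real) \<Rightarrow> 'a \<Rightarrow> real" where
  "letter_expect K g a = (\<Sum>y\<in>UNIV. K a y * g a y)"

lemma sum_lists_length_Suc:
  fixes f :: "'y::finite list \<Rightarrow> 'b::comm_monoid_add"
  shows "(\<Sum>ys | length ys = Suc n. f ys) = (\<Sum>y\<in>UNIV. \<Sum>ys | length ys = n. f (y # ys))"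
proof -
  have "(\<Sum>ys | length ys = Suc n. f ys)
      = (\<Sum>p\<in>UNIV \<times> {ys. length ys = n}. f (fst p # snd p))"
    by (rule sum.reindex_bij_witness[where i = "\<lambda>p. fst p # snd p" and j = "\<lambda>ys. (hd ys, tl ys)"])
      (auto simp: length_Suc_conv)
  also have "\<dots> = (\<Sum>y\<in>UNIV. \<Sum>ys | length ys = n. f (y # ys))"
    by (simp add: sum.cartesian_product case_prod_beta)
  finally show ?thesis .
qed

lemma block_expect_Nil [simp]: "block_expect K [] F = F []"
  by (simp add: block_expect_def)

lemma block_expect_Cons:
  "block_expect K (a # as) F = (\<Sum>y\<in>UNIV. K a y * block_expect K as (\<lambda>ys. F (y # ys)))"
  by (simp add: block_expect_def sum_lists_length_Suc sum_distrib_left mult.assoc)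

lemma block_expect_add:
  "block_expect K as (\<lambda>ys. F ys + G ys) = block_expect K as F + block_expect K as G"
  by (simp add: block_expect_def distrib_left sum.distrib)

lemma block_expect_diff:
  "block_expect K as (\<lambda>ys. F ys - G ys) = block_expect K as F - block_expect K as G"
  by (simp add: block_expect_def right_diff_distrib sum_subtractf)

lemma block_expect_cmult: "block_expect K as (\<lambda>ys. c * F ys) = c * block_expect K as F"
  by (simp add: block_expect_def sum_distrib_left mult_ac)

lemma block_expect_sum:
  "block_expect K as (\<lambda>ys. \<Sum>j\<in>A. F j ys) = (\<Sum>j\<in>A. block_expect K as (F j))"
  unfolding block_expect_def sum_distrib_left by (rule sum.swap)

lemma block_expect_const:
  assumes "is_channel_on (set as) K"
  shows "block_expect K as (\<lambda>ys. c) = c"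
  using assms
  by (induction as) (auto simp: block_expect_Cons is_pmf_def simp flip: sum_distrib_right)

lemma block_expect_mono:
  assumes "is_channel_on (set as) K"
    and "\<And>ys. length ys = length as \<Longrightarrow> Wn K (length as) as ys \<noteq> 0 \<Longrightarrow> F ys \<le> G ys"
  shows "block_expect K as F \<le> block_expect K as G"
  unfolding block_expect_def
proof (rule sum_mono)
  fix ys :: "'b list" assume "ys \<in> {ys. length ys = length as}"
  then show "Wn K (length as) as ys * F ys \<le> Wn K (length as) as ys * G ys"
    using assms(2)[of ys] Wn_nonneg[OF assms(1), of ys]
    by (cases "Wn K (length as) as ys = 0") (auto intro: mult_left_mono)
qed

lemma block_expect_cong:
  assumes "length as = length bs"
    and "\<And>i y. i < length as \<Longrightarrow> K (as ! i) y = L (bs ! i) y"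
    and "\<And>ys. length ys = length as \<Longrightarrow> F ys = G ys"
  shows "block_expect K as F = block_expect L bs G"
  unfolding block_expect_def Wn_def using assms by (intro sum.cong) auto

lemma block_expect_nonneg:
  assumes "is_channel_on (set as) K" "\<And>ys. 0 \<le> F ys"
  shows "0 \<le> block_expect K as F"
  unfolding block_expect_def by (intro sum_nonneg mult_nonneg_nonneg Wn_nonneg assms)

lemma block_expect_nonneg_eq_0_iff:
  fixes K :: "'a \<Rightarrow> 'y::finite \<Rightarrow> real"
  assumes "is_channel_on (set as) K" "\<And>ys. 0 \<le> F ys"
  shows "block_expect K as F = 0 \<longleftrightarrow>
    (\<forall>ys. length ys = length as \<longrightarrow> Wn K (length as) as ys \<noteq> 0 \<longrightarrow> F ys = 0)"
proof -
  have "finite {ys :: 'y list. length ys = length as}"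
    using finite_lists_length_eq[of "UNIV :: 'y set"] by simp
  then show ?thesis unfolding block_expect_def
    using Wn_nonneg[OF assms(1)] assms(2) by (subst sum_nonneg_eq_0_iff) auto
qed

lemma block_prob_nonneg: "is_channel_on (set as) K \<Longrightarrow> 0 \<le> block_prob K as A"
  unfolding block_prob_def by (rule block_expect_nonneg) simp_all

lemma block_prob_mono:
  assumes "is_channel_on (set as) K"
    and "\<And>ys. length ys = length as \<Longrightarrow> Wn K (length as) as ys \<noteq> 0 \<Longrightarrow> ys \<in> A \<Longrightarrow> ys \<in> B"
  shows "block_prob K as A \<le> block_prob K as B"
  unfolding block_prob_def using assms by (intro block_expect_mono) (auto simp: indicator_def)

lemma block_prob_UNIV: "is_channel_on (set as) K \<Longrightarrow> block_prob K as UNIV = 1"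
  by (simp add: block_prob_def block_expect_const)

lemma block_prob_le_1: "is_channel_on (set as) K \<Longrightarrow> block_prob K as A \<le> 1"
  using block_prob_mono[of as K A UNIV] by (simp add: block_prob_UNIV)

section \<open>Moments of letter sums\<close>

lemma block_expect_qn:
  assumes "is_channel_on (set as) K"
  shows "block_expect K as (qn g (length as) as) = (\<Sum>a\<leftarrow>as. letter_expect K g a)"
  using assms
proof (induction as)
  case (Cons a as)
  then show ?case
    by (simp add: block_expect_Cons block_expect_add block_expect_const letter_expect_def is_pmf_def
        distrib_left sum.distrib flip: sum_distrib_right)
qed simp

lemma block_expect_add_square:
  assumes "is_channel_on (set as) K" "block_expect K as S = 0"
  shows "block_expect K as (\<lambda>ys. (t + S ys)\<^sup>2) = t\<^sup>2 + block_expect K as (\<lambda>ys. (S ys)\<^sup>2)"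
proof -
  have "block_expect K as (\<lambda>ys. (t + S ys)\<^sup>2)
      = block_expect K as (\<lambda>ys. t\<^sup>2 + (2 * t * S ys + (S ys)\<^sup>2))"
    by (simp add: power2_sum algebra_simps)
  then show ?thesis
    by (simp add: block_expect_add block_expect_cmult block_expect_const assms)
qed

lemma block_expect_add_pow4:
  assumes "is_channel_on (set as) K" "block_expect K as S = 0"
  shows "block_expect K as (\<lambda>ys. (t + S ys) ^ 4)
    = t ^ 4 + 6 * t\<^sup>2 * block_expect K as (\<lambda>ys. (S ys)\<^sup>2)
    + 4 * t * block_expect K as (\<lambda>ys. S ys ^ 3) + block_expect K as (\<lambda>ys. S ys ^ 4)"
proof -
  have "block_expect K as (\<lambda>ys. (t + S ys) ^ 4) = block_expect K as (\<lambda>ys. t ^ 4 + ((4 * t ^ 3) * S ys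
      + ((6 * t\<^sup>2) * (S ys)\<^sup>2 + ((4 * t) * S ys ^ 3 + S ys ^ 4))))"
    by (rule arg_cong[where f = "block_expect K as"]) (rule ext, algebra)
  then show ?thesis
    by (simp add: block_expect_add block_expect_cmult block_expect_const assms)
qed

lemma block_expect_qn_square:
  assumes "is_channel_on (set as) K" "\<And>a. a \<in> set as \<Longrightarrow> letter_expect K g a = 0"
  shows "block_expect K as (\<lambda>ys. (qn g (length as) as ys)\<^sup>2)
    = (\<Sum>a\<leftarrow>as. letter_expect K (\<lambda>a y. (g a y)\<^sup>2) a)"
  using assms
proof (induction as)
  case (Cons a as)
  then have K: "(\<Sum>y\<in>UNIV. K a y) = 1" and channel: "is_channel_on (set as) K"
    and mean: "block_expect K as (qn g (length as) as) = 0"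
    by (simp_all add: is_pmf_def block_expect_qn cong: map_cong)
  show ?case
    using Cons block_expect_add_square[OF channel mean]
    by (simp add: block_expect_Cons letter_expect_def distrib_left sum.distrib K
        flip: sum_distrib_right)
qed simp

lemma letter_expect_pow4_le:
  assumes "is_pmf (K a)" "\<And>y. (g a y)\<^sup>2 \<le> B"
  shows "letter_expect K (\<lambda>a y. g a y ^ 4) a \<le> B * letter_expect K (\<lambda>a y. (g a y)\<^sup>2) a"
  unfolding letter_expect_def sum_distrib_left
proof (rule sum_mono)
  fix y
  have "(g a y)\<^sup>2 * (K a y * (g a y)\<^sup>2) \<le> B * (K a y * (g a y)\<^sup>2)"
    using assms by (intro mult_right_mono) (auto simp: is_pmf_def)
  then show "K a y * g a y ^ 4 \<le> B * (K a y * (g a y)\<^sup>2)"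
    by (simp add: power4_eq_xxxx power2_eq_square mult_ac)
qed

lemma block_expect_qn_pow4_le:
  assumes "is_channel_on (set as) K" "\<And>a. a \<in> set as \<Longrightarrow> letter_expect K g a = 0"
    and "\<And>a y. a \<in> set as \<Longrightarrow> (g a y)\<^sup>2 \<le> B"
  defines "s \<equiv> \<Sum>a\<leftarrow>as. letter_expect K (\<lambda>a y. (g a y)\<^sup>2) a"
  shows "block_expect K as (\<lambda>ys. qn g (length as) as ys ^ 4) \<le> 3 * s\<^sup>2 + B * s"
  using assms(1-3) unfolding s_def
proof (induction as)
  case (Cons a as)
  define s where "s = (\<Sum>a\<leftarrow>as. letter_expect K (\<lambda>a y. (g a y)\<^sup>2) a)"
  define v where "v = letter_expect K (\<lambda>a y. (g a y)\<^sup>2) a"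
  define third where "third = block_expect K as (\<lambda>ys. qn g (length as) as ys ^ 3)"
  define fourth where "fourth = block_expect K as (\<lambda>ys. qn g (length as) as ys ^ 4)"
  have pmf: "is_pmf (K a)" and K: "(\<Sum>y\<in>UNIV. K a y) = 1" and channel: "is_channel_on (set as) K"
    and g: "(\<Sum>y\<in>UNIV. K a y * g a y) = 0"
    using Cons.prems(1) Cons.prems(2)[of a] by (simp_all add: is_pmf_def letter_expect_def)
  have mean: "block_expect K as (qn g (length as) as) = 0"
    using block_expect_qn[OF channel, of g] Cons.prems(2) by (simp cong: map_cong)
  have second: "block_expect K as (\<lambda>ys. (qn g (length as) as ys)\<^sup>2) = s"
    using block_expect_qn_square[OF channel] Cons.prems(2) by (simp add: s_def)
  have "block_expect K (a # as) (\<lambda>ys. qn g (length (a # as)) (a # as) ys ^ 4)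
      = (\<Sum>y\<in>UNIV. K a y * g a y ^ 4 + 6 * s * (K a y * (g a y)\<^sup>2)
          + 4 * third * (K a y * g a y) + K a y * fourth)"
    using block_expect_add_pow4[OF channel mean]
    by (simp add: block_expect_Cons second third_def fourth_def algebra_simps)
  also have "\<dots> = letter_expect K (\<lambda>a y. g a y ^ 4) a + 6 * s * v + fourth"
    by (simp add: sum.distrib K g v_def letter_expect_def flip: sum_distrib_left sum_distrib_right)
  also have "letter_expect K (\<lambda>a y. g a y ^ 4) a \<le> B * v"
    unfolding v_def using Cons.prems(3) by (intro letter_expect_pow4_le pmf) simp
  also have "fourth \<le> 3 * s\<^sup>2 + B * s"
    using Cons channel by (simp add: fourth_def s_def)
  also have "B * v + 6 * s * v + (3 * s\<^sup>2 + B * s) \<le> 3 * (v + s)\<^sup>2 + B * (v + s)"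
    using zero_le_power2[of v] by (simp add: power2_sum algebra_simps)
  finally show ?case by (simp add: v_def s_def)
qed simp

definition centred :: "('a \<Rightarrow> 'y::finite \<Rightarrow> real) \<Rightarrow> ('a \<Rightarrow> 'y \<Rightarrow> real) \<Rightarrow> 'a \<Rightarrow> 'y \<Rightarrow> real" where
  "centred K g a y = g a y - letter_expect K g a"

lemma letter_expect_centred: "is_pmf (K a) \<Longrightarrow> letter_expect K (centred K g) a = 0"
  by (simp add: letter_expect_def centred_def is_pmf_def right_diff_distrib sum_subtractf
      flip: sum_distrib_right)

lemma qn_centred:
  "qn (centred K g) (length as) as ys = qn g (length as) as ys - (\<Sum>a\<leftarrow>as. letter_expect K g a)"
  by (simp add: qn_def centred_def sum_subtractf sum_list_sum_nth atLeast0LessThan)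

lemma block_prob_deviation_le:
  fixes t v :: real
  assumes channel: "is_channel_on (set as) K" and "0 < t"
    and bound: "\<And>a y. a \<in> set as \<Longrightarrow> (centred K g a y)\<^sup>2 \<le> v"
  shows "block_prob K as {ys. (\<Sum>a\<leftarrow>as. letter_expect K g a) + t \<le> qn g (length as) as ys}
    \<le> length as * v / t\<^sup>2"
proof -
  let ?S = "qn (centred K g) (length as) as"
  have variance: "letter_expect K (\<lambda>a y. (centred K g a y)\<^sup>2) a \<le> v" if "a \<in> set as" for a
  proof -
    have "is_pmf (K a)" using channel that by (simp add: is_channel_on_def)
    moreover have "letter_expect K (\<lambda>a y. (centred K g a y)\<^sup>2) a \<le> (\<Sum>y\<in>UNIV. K a y * v)"
      unfolding letter_expect_def using bound that \<open>is_pmf (K a)\<close>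
      by (intro sum_mono mult_left_mono) (auto simp: is_pmf_def)
    ultimately show ?thesis by (simp add: is_pmf_def flip: sum_distrib_right)
  qed
  have "block_prob K as {ys. (\<Sum>a\<leftarrow>as. letter_expect K g a) + t \<le> qn g (length as) as ys}
      \<le> block_expect K as (\<lambda>ys. (1 / t\<^sup>2) * (?S ys)\<^sup>2)"
    unfolding block_prob_def
  proof (rule block_expect_mono[OF channel])
    fix ys
    have "t\<^sup>2 \<le> (?S ys)\<^sup>2" if "t \<le> ?S ys" using that \<open>0 < t\<close> by (intro power_mono) auto
    then show "indicator {ys. (\<Sum>a\<leftarrow>as. letter_expect K g a) + t \<le> qn g (length as) as ys} ys
        \<le> (1 / t\<^sup>2) * (?S ys)\<^sup>2"
      using \<open>0 < t\<close> by (auto simp: indicator_def qn_centred le_divide_eq)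
  qed
  also have "\<dots> = (1 / t\<^sup>2) * (\<Sum>a\<leftarrow>as. letter_expect K (\<lambda>a y. (centred K g a y)\<^sup>2) a)"
    using channel letter_expect_centred
    by (simp only: block_expect_cmult)
      (subst block_expect_qn_square; fastforce simp: is_channel_on_def)
  also have "\<dots> \<le> (1 / t\<^sup>2) * (\<Sum>a\<leftarrow>as. v)"
    by (intro mult_left_mono sum_list_mono variance) auto
  finally show ?thesis by (simp add: sum_list_triv)
qed

section \<open>Anticoncentration\<close>

(* The left-hand side is 2 w^3 t + 3 w^2 t^2 - t^4: without a cubic term, its expectation at a
   centred variable involves the second and fourth moments only. *)
lemma quartic_le_nonneg_indicator:
  fixes t w :: real
  assumes "0 < w"
  shows "t * (2 * w - t) * (w + t)\<^sup>2 \<le> 9 * w ^ 4 * of_bool (0 \<le> t)"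
proof (cases "0 \<le> t \<and> t \<le> 2 * w")
  case True
  have "t * (2 * w - t) = w\<^sup>2 - (t - w)\<^sup>2" by (simp add: power2_eq_square algebra_simps)
  then have "t * (2 * w - t) \<le> w\<^sup>2" by simp
  moreover have "(w + t)\<^sup>2 \<le> (3 * w)\<^sup>2" using True assms by (intro power_mono) auto
  ultimately have "t * (2 * w - t) * (w + t)\<^sup>2 \<le> w\<^sup>2 * (3 * w)\<^sup>2"
    using assms by (intro mult_mono) auto
  then show ?thesis using True by (simp add: power2_eq_square power4_eq_xxxx mult_ac)
next
  case False
  then have "t * (2 * w - t) \<le> 0" using assms by (auto simp: mult_le_0_iff)
  then have "t * (2 * w - t) * (w + t)\<^sup>2 \<le> 0" by (simp add: mult_nonpos_nonneg)
  then show ?thesis using assms by (simp add: order_trans)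
qed

lemma block_prob_nonneg_ge_of_moments:
  assumes channel: "is_channel_on (set as) K" and mean: "block_expect K as S = 0"
    and fourth: "block_expect K as (\<lambda>ys. S ys ^ 4) \<le> C * (block_expect K as (\<lambda>ys. (S ys)\<^sup>2))\<^sup>2"
    and "0 < block_expect K as (\<lambda>ys. (S ys)\<^sup>2)" "0 < C"
  shows "2 / (9 * C) \<le> block_prob K as {ys. 0 \<le> S ys}"
proof -
  define s where "s = block_expect K as (\<lambda>ys. (S ys)\<^sup>2)"
  define w where "w = sqrt (C * s)"
  have pos: "0 < s" "0 < w" using assms by (simp_all add: s_def w_def)
  have w: "w\<^sup>2 = C * s" "w ^ 4 = C\<^sup>2 * s\<^sup>2"
    using assms(5) pos(1) by (simp_all add: w_def power4_eq_xxxx power2_eq_square)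
  have "2 * C * s\<^sup>2 \<le> 2 * w ^ 3 * 0 + (3 * w\<^sup>2) * s - block_expect K as (\<lambda>ys. S ys ^ 4)"
    using fourth unfolding s_def[symmetric] w(1) by (simp add: power2_eq_square mult_ac)
  also have "\<dots> = block_expect K as (\<lambda>ys. 2 * w ^ 3 * S ys + (3 * w\<^sup>2) * (S ys)\<^sup>2 - S ys ^ 4)"
    by (simp only: block_expect_add block_expect_diff block_expect_cmult mean s_def)
  also have "\<dots> = block_expect K as (\<lambda>ys. S ys * (2 * w - S ys) * (w + S ys)\<^sup>2)"
    by (rule arg_cong[where f = "block_expect K as"])
      (simp add: fun_eq_iff power2_eq_square power3_eq_cube power4_eq_xxxx algebra_simps)
  also have "\<dots> \<le> block_expect K as (\<lambda>ys. 9 * w ^ 4 * indicator {ys. 0 \<le> S ys} ys)"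
    using quartic_le_nonneg_indicator[OF pos(2)]
    by (intro block_expect_mono channel) (simp add: indicator_def)
  also have "\<dots> = 9 * (C\<^sup>2 * s\<^sup>2) * block_prob K as {ys. 0 \<le> S ys}"
    by (simp add: block_expect_cmult block_prob_def w(2))
  finally show ?thesis using assms(5) pos(1) by (simp add: field_simps power2_eq_square)
qed

lemma block_prob_nonneg_eq_1:
  assumes channel: "is_channel_on (set as) K" and "block_expect K as (\<lambda>ys. (S ys)\<^sup>2) = 0"
  shows "block_prob K as {ys. 0 \<le> S ys} = 1"
proof -
  have "\<forall>ys. length ys = length as \<longrightarrow> Wn K (length as) as ys \<noteq> 0 \<longrightarrow> S ys = 0"
    using assms(2) by (simp add: block_expect_nonneg_eq_0_iff[OF channel])
  then have "block_prob K as UNIV \<le> block_prob K as {ys. 0 \<le> S ys}"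
    by (intro block_prob_mono channel) auto
  then show ?thesis
    using block_prob_le_1[OF channel] by (simp add: block_prob_UNIV[OF channel] antisym)
qed

lemma block_prob_qn_nonneg_ge:
  assumes channel: "is_channel_on (set as) K"
    and mean: "\<And>a. a \<in> set as \<Longrightarrow> letter_expect K g a = 0"
    and bound: "\<And>a y. a \<in> set as \<Longrightarrow> (g a y)\<^sup>2 \<le> B"
    and variance: "\<And>a. a \<in> set as \<Longrightarrow> letter_expect K (\<lambda>a y. (g a y)\<^sup>2) a \<noteq> 0 \<Longrightarrow>
      \<sigma> \<le> letter_expect K (\<lambda>a y. (g a y)\<^sup>2) a"
    and "0 < \<sigma>" "0 \<le> B"
  shows "2 / (9 * (3 + B / \<sigma>)) \<le> block_prob K as {ys. 0 \<le> qn g (length as) as ys}"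
proof -
  define C where "C = 3 + B / \<sigma>"
  define s where "s = (\<Sum>a\<leftarrow>as. letter_expect K (\<lambda>a y. (g a y)\<^sup>2) a)"
  let ?S = "qn g (length as) as"
  have "3 \<le> C" using assms(5,6) by (simp add: C_def)
  have second: "block_expect K as (\<lambda>ys. (?S ys)\<^sup>2) = s"
    using block_expect_qn_square[OF channel mean] by (simp add: s_def)
  have "2 / (9 * C) \<le> block_prob K as {ys. 0 \<le> ?S ys}"
  proof (cases "s = 0")
    case True
    then show ?thesis using \<open>3 \<le> C\<close> by (simp add: block_prob_nonneg_eq_1[OF channel] second)
  next
    case False
    then obtain a where a: "a \<in> set as" "letter_expect K (\<lambda>a y. (g a y)\<^sup>2) a \<noteq> 0"
      unfolding s_def by (metis (mono_tags, lifting) map_eq_conv sum_list_0)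
    have "0 \<le> letter_expect K (\<lambda>a y. (g a y)\<^sup>2) a" if "a \<in> set as" for a
      using channel that unfolding letter_expect_def
      by (intro sum_nonneg) (auto simp: is_channel_on_def is_pmf_def)
    then have "letter_expect K (\<lambda>a y. (g a y)\<^sup>2) a \<le> s"
      unfolding s_def using a(1) by (intro member_le_sum_list) auto
    with variance[OF a] have "\<sigma> \<le> s" by (rule order_trans)
    then have "B * s * \<sigma> \<le> B * s * s" using assms(5,6) by (intro mult_left_mono) auto
    then have "3 * s\<^sup>2 + B * s \<le> C * s\<^sup>2"
      using assms(5) by (simp add: C_def field_simps power2_eq_square)
    then have "block_expect K as (\<lambda>ys. ?S ys ^ 4) \<le> C * s\<^sup>2"
      using block_expect_qn_pow4_le[OF channel mean bound] by (simp add: s_def)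
    then show ?thesis
      using \<open>\<sigma> \<le> s\<close> \<open>0 < \<sigma>\<close> \<open>3 \<le> C\<close> block_expect_qn[OF channel, of g] mean
      by (intro block_prob_nonneg_ge_of_moments channel) (simp_all add: second cong: map_cong)
  qed
  then show ?thesis by (simp add: C_def)
qed

lemma uniform_block_prob_qn_nonneg:
  fixes K g :: "'a::finite \<Rightarrow> 'y::finite \<Rightarrow> real"
  obtains c where "0 < c" "\<And>as. is_channel_on (set as) K \<Longrightarrow>
    0 \<le> (\<Sum>a\<leftarrow>as. letter_expect K g a) \<Longrightarrow> c \<le> block_prob K as {ys. 0 \<le> qn g (length as) as ys}"
proof -
  let ?h = "centred K g"
  let ?var = "letter_expect K (\<lambda>a y. (?h a y)\<^sup>2)"
  obtain B where B: "0 < B" "\<And>a y. (?h a y)\<^sup>2 \<le> B"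
    using finite_type_upper_bound[of "\<lambda>a y. (?h a y)\<^sup>2"] by blast
  obtain \<sigma> where \<sigma>: "0 < \<sigma>" "\<And>a. 0 < ?var a \<Longrightarrow> \<sigma> \<le> ?var a"
    by (rule finite_positive_lower_bound[of "{a. 0 < ?var a}" ?var]) simp_all
  show thesis
  proof (rule that[of "2 / (9 * (3 + B / \<sigma>))"])
    show "0 < 2 / (9 * (3 + B / \<sigma>))" using B(1) \<sigma>(1) by (simp add: add_pos_pos)
    fix as
    assume channel: "is_channel_on (set as) K" and mean: "0 \<le> (\<Sum>a\<leftarrow>as. letter_expect K g a)"
    have "2 / (9 * (3 + B / \<sigma>)) \<le> block_prob K as {ys. 0 \<le> qn ?h (length as) as ys}"
    proof (rule block_prob_qn_nonneg_ge[OF channel])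
      fix a assume "a \<in> set as"
      then have pmf: "is_pmf (K a)" using channel by (simp add: is_channel_on_def)
      show "letter_expect K ?h a = 0" using pmf by (rule letter_expect_centred)
      have "0 \<le> ?var a" using pmf unfolding letter_expect_def
        by (intro sum_nonneg) (simp add: is_pmf_def)
      then show "\<sigma> \<le> ?var a" if "?var a \<noteq> 0" using \<sigma>(2) that by simp
    qed (use B \<sigma>(1) in auto)
    also have "\<dots> \<le> block_prob K as {ys. 0 \<le> qn g (length as) as ys}"
      using mean by (intro block_prob_mono channel) (simp add: qn_centred)
    finally show "2 / (9 * (3 + B / \<sigma>)) \<le> block_prob K as {ys. 0 \<le> qn g (length as) as ys}" .
  qed
qed

section \<open>Joint types\<close>

lemma card_multisets_of_size_le:
  assumes "finite A"
  shows "card (multisets_of_size A n) \<le> (n + card A) ^ card A"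
proof (cases "card A")
  case 0
  then show ?thesis by (cases n) (use assms in auto)
next
  case (Suc k)
  have "card (multisets_of_size A n) = (k + n) choose k"
    using Suc by (simp add: card_multisets_of_size[OF assms] binomial_symmetric[of n])
  also have "\<dots> \<le> (k + n) ^ k" by (rule binomial_le_pow) simp
  also have "\<dots> \<le> (n + card A) ^ k" using Suc by (intro power_mono) auto
  also have "\<dots> \<le> (n + card A) ^ card A" using Suc by (intro power_increasing) auto
  finally show ?thesis .
qed

definition isolated :: "'x list list \<Rightarrow> nat \<Rightarrow> 'y list \<Rightarrow> bool" where
  "isolated C m zs \<longleftrightarrow>
     (\<forall>m'<length C. m' \<noteq> m \<longrightarrow> mset (zip (C ! m') zs) \<noteq> mset (zip (C ! m) zs))"

lemma card_isolated_le:
  fixes C :: "'x::finite list list" and zs :: "'y::finite list"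
  assumes "\<And>c. c \<in> set C \<Longrightarrow> length c = length zs"
  shows "card {m. m < length C \<and> isolated C m zs} \<le> (length zs + CARD('x \<times> 'y)) ^ CARD('x \<times> 'y)"
proof -
  define A where "A = {m. m < length C \<and> isolated C m zs}"
  have "inj_on (\<lambda>m. mset (zip (C ! m) zs)) A"
    unfolding inj_on_def A_def isolated_def by (metis (mono_tags, lifting) mem_Collect_eq)
  moreover have "(\<lambda>m. mset (zip (C ! m) zs)) ` A \<subseteq> multisets_of_size UNIV (length zs)"
    using assms by (auto simp: A_def multisets_of_size_def)
  ultimately have "card A \<le> card (multisets_of_size (UNIV :: ('x \<times> 'y) set) (length zs))"
    by (intro card_inj_on_le finite_multisets_of_size) auto
  also have "\<dots> \<le> (length zs + CARD('x \<times> 'y)) ^ CARD('x \<times> 'y)"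
    by (rule card_multisets_of_size_le) simp
  finally show ?thesis by (simp add: A_def)
qed

lemma sum_block_prob_isolated_le:
  fixes C :: "'x::finite list list" and Q :: "'y::finite \<Rightarrow> real"
  assumes C: "is_codebook n C" and Q: "is_pmf Q"
  shows "(\<Sum>m<length C. block_prob (\<lambda>_. Q) (C ! m) {zs. isolated C m zs})
    \<le> (n + CARD('x \<times> 'y)) ^ CARD('x \<times> 'y)"
proof -
  let ?d = "CARD('x \<times> 'y)"
  have len: "\<And>c. c \<in> set C \<Longrightarrow> length c = n" using C by (simp add: is_codebook_def)
  define xs where "xs = hd C"
  have xs: "length xs = n" using C len by (simp add: xs_def is_codebook_def)
  have "(\<Sum>m<length C. block_prob (\<lambda>_. Q) (C ! m) {zs. isolated C m zs})
      = (\<Sum>m<length C. block_expect (\<lambda>_. Q) xs (\<lambda>zs. of_bool (isolated C m zs)))"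
    unfolding block_prob_def
    by (intro sum.cong refl block_expect_cong) (simp_all add: len xs indicator_def)
  also have "\<dots> = block_expect (\<lambda>_. Q) xs (\<lambda>zs. real (card {m. m < length C \<and> isolated C m zs}))"
    by (simp add: lessThan_def Collect_conj_eq flip: block_expect_sum)
  also have "\<dots> \<le> block_expect (\<lambda>_. Q) xs (\<lambda>zs. real ((n + ?d) ^ ?d))"
  proof (intro block_expect_mono is_pmf_imp_is_channel_on Q of_nat_mono)
    fix zs :: "'y list"
    assume "length zs = length xs"
    then show "card {m. m < length C \<and> isolated C m zs} \<le> (n + ?d) ^ ?d"
      using card_isolated_le[of C zs] len xs by simp
  qed
  also have "\<dots> = (n + ?d) ^ ?d"
    by (intro block_expect_const is_pmf_imp_is_channel_on Q)
  finally show ?thesis .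
qed

section \<open>The maximality condition and circulations\<close>

(* Equal to 0, hence not a pmf, where the marginal vanishes. *)
definition cond_Y :: "('x \<Rightarrow> 'y::finite \<Rightarrow> 'y \<Rightarrow> real) \<Rightarrow> 'x \<times> 'y \<Rightarrow> 'y \<Rightarrow> real" where
  "cond_Y V = (\<lambda>(x, z) y. V x y z / marg_Yhat V x z)"

definition mean_gain ::
    "('x \<Rightarrow> 'y::finite \<Rightarrow> real) \<Rightarrow> ('x \<Rightarrow> 'y \<Rightarrow> 'y \<Rightarrow> real) \<Rightarrow> 'x \<Rightarrow> 'y \<Rightarrow> 'x \<Rightarrow> real" where
  "mean_gain q V x z x' = (\<Sum>y\<in>UNIV. cond_Y V (x, z) y * (q x' y - q x y))"

lemma mean_gain_refl [simp]: "mean_gain q V x z x = 0"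
  by (simp add: mean_gain_def)

lemma is_channel_marg_Yhat:
  assumes "is_cond_pmf2 V"
  shows "is_channel (marg_Yhat V)"
proof -
  have "(\<Sum>z\<in>UNIV. \<Sum>y\<in>UNIV. V x y z) = 1" for x
    using assms by (subst sum.swap) (auto simp: is_cond_pmf2_def)
  then show ?thesis using assms
    by (auto simp: is_channel_def is_pmf_def marg_Yhat_def is_cond_pmf2_def intro!: sum_nonneg)
qed

lemma is_channel_marg_Y: "is_cond_pmf2 V \<Longrightarrow> is_channel (marg_Y V)"
  by (simp add: is_channel_def is_pmf_def marg_Y_def is_cond_pmf2_def sum_nonneg)

lemma marg_Yhat_nonneg: "is_cond_pmf2 V \<Longrightarrow> 0 \<le> marg_Yhat V x z"
  by (simp add: marg_Yhat_def is_cond_pmf2_def sum_nonneg)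

lemma is_pmf_cond_Y:
  assumes "is_cond_pmf2 V" "0 < marg_Yhat V x z"
  shows "is_pmf (cond_Y V (x, z))"
proof -
  have "(\<Sum>y\<in>UNIV. V x y z / marg_Yhat V x z) = 1"
    using assms(2) by (simp add: marg_Yhat_def flip: sum_divide_distrib)
  then show ?thesis
    using assms by (simp add: is_pmf_def cond_Y_def is_cond_pmf2_def)
qed

lemma marg_Yhat_times_cond_Y:
  assumes "is_cond_pmf2 V"
  shows "marg_Yhat V x z * cond_Y V (x, z) y = V x y z"
proof (cases "marg_Yhat V x z = 0")
  case True
  then have "V x y z = 0" using assms unfolding marg_Yhat_def is_cond_pmf2_def
    by (subst (asm) sum_nonneg_eq_0_iff) auto
  then show ?thesis using True by simp
qed (simp add: cond_Y_def)

lemma marg_Yhat_times_mean_gain: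
  assumes "is_cond_pmf2 V"
  shows "marg_Yhat V x z * mean_gain q V x z x' = (\<Sum>y\<in>UNIV. V x y z * (q x' y - q x y))"
  by (simp add: mean_gain_def sum_distrib_left marg_Yhat_times_cond_Y[OF assms] flip: mult.assoc)

lemma coupled_metric_difference:
  fixes q :: "'x::finite \<Rightarrow> 'y::finite \<Rightarrow> real"
  assumes V: "is_cond_pmf2 V" and U: "\<And>x1 z. is_pmf (U x1 z)"
  shows "(\<Sum>x1\<in>UNIV. \<Sum>z\<in>UNIV. \<Sum>x2\<in>UNIV. P x1 * marg_Yhat V x1 z * U x1 z x2 * mean_gain q V x1 z x2)
    = (\<Sum>x1\<in>UNIV. \<Sum>y\<in>UNIV. \<Sum>z\<in>UNIV. \<Sum>x2\<in>UNIV. P x1 * V x1 y z * U x1 z x2 * q x2 y)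
      - (\<Sum>x1\<in>UNIV. \<Sum>y\<in>UNIV. \<Sum>z\<in>UNIV. P x1 * V x1 y z * q x1 y)"
proof -
  have "(\<Sum>z\<in>UNIV. \<Sum>x2\<in>UNIV. P x1 * marg_Yhat V x1 z * U x1 z x2 * mean_gain q V x1 z x2)
      = (\<Sum>y\<in>UNIV. \<Sum>z\<in>UNIV. \<Sum>x2\<in>UNIV. P x1 * V x1 y z * U x1 z x2 * q x2 y)
        - (\<Sum>y\<in>UNIV. \<Sum>z\<in>UNIV. P x1 * V x1 y z * q x1 y)" for x1
  proof -
    have "(\<Sum>z\<in>UNIV. \<Sum>x2\<in>UNIV. P x1 * marg_Yhat V x1 z * U x1 z x2 * mean_gain q V x1 z x2)
        = (\<Sum>z\<in>UNIV. \<Sum>x2\<in>UNIV. P x1 * U x1 z x2 * (marg_Yhat V x1 z * mean_gain q V x1 z x2))"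
      by (simp only: mult_ac)
    also have "\<dots> = (\<Sum>z\<in>UNIV. \<Sum>x2\<in>UNIV. \<Sum>y\<in>UNIV. P x1 * U x1 z x2 * (V x1 y z * (q x2 y - q x1 y)))"
      by (simp only: marg_Yhat_times_mean_gain[OF V] sum_distrib_left)
    also have "\<dots> = (\<Sum>z\<in>UNIV. \<Sum>y\<in>UNIV. \<Sum>x2\<in>UNIV. P x1 * U x1 z x2 * (V x1 y z * (q x2 y - q x1 y)))"
      by (intro sum.cong refl sum.swap)
    also have "\<dots> = (\<Sum>y\<in>UNIV. \<Sum>z\<in>UNIV. \<Sum>x2\<in>UNIV. P x1 * U x1 z x2 * (V x1 y z * (q x2 y - q x1 y)))"
      by (rule sum.swap)
    also have "\<dots> = (\<Sum>y\<in>UNIV. \<Sum>z\<in>UNIV. (\<Sum>x2\<in>UNIV. P x1 * V x1 y z * U x1 z x2 * q x2 y)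
        - P x1 * V x1 y z * q x1 y * (\<Sum>x2\<in>UNIV. U x1 z x2))"
      by (simp add: sum_distrib_left algebra_simps flip: sum_subtractf)
    finally show ?thesis using U by (simp add: is_pmf_def sum_subtractf)
  qed
  then show ?thesis by (simp only: sum_subtractf)
qed

lemma Mmax_iff:
  fixes q :: "'x::finite \<Rightarrow> 'y::finite \<Rightarrow> real"
  shows "V \<in> Mmax q P \<longleftrightarrow> is_cond_pmf2 V \<and>
    (\<forall>U :: 'x \<Rightarrow> 'y \<Rightarrow> 'x \<Rightarrow> real. (\<forall>x1 z. is_pmf (U x1 z)) \<longrightarrow>
      (\<forall>z x2. (\<Sum>x1\<in>UNIV. P x1 * marg_Yhat V x1 z * U x1 z x2) = P x2 * marg_Yhat V x2 z) \<longrightarrow>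
      0 \<le> (\<Sum>x1\<in>UNIV. \<Sum>z\<in>UNIV. \<Sum>x2\<in>UNIV.
        P x1 * marg_Yhat V x1 z * U x1 z x2 * mean_gain q V x1 z x2))"
proof -
  have "(\<Sum>x1\<in>UNIV. \<Sum>y\<in>UNIV. P x1 * V x1 y z * U x1 z x2)
      = (\<Sum>x1\<in>UNIV. P x1 * marg_Yhat V x1 z * U x1 z x2)" for z x2 and U :: "'x \<Rightarrow> 'y \<Rightarrow> 'x \<Rightarrow> real"
    by (simp add: marg_Yhat_def sum_distrib_left sum_distrib_right)
  moreover have "(\<Sum>y\<in>UNIV. P x * V x y z) = P x * marg_Yhat V x z" for x z
    by (simp add: marg_Yhat_def sum_distrib_left)
  ultimately show ?thesis
    unfolding Mmax_def by (auto simp: coupled_metric_difference)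
qed

lemma Mmax_imp_is_cond_pmf2: "V \<in> Mmax q P \<Longrightarrow> is_cond_pmf2 V"
  by (simp add: Mmax_iff)

lemma coupling_of_circulation:
  fixes w :: "'x::finite \<Rightarrow> 'z::finite \<Rightarrow> real"
  assumes w: "\<And>x z. 0 \<le> w x z" and J: "\<And>x1 z x2. 0 \<le> J x1 z x2"
    and supp: "\<And>x1 z x2. w x1 z = 0 \<Longrightarrow> J x1 z x2 = 0"
    and circ: "\<And>z x. (\<Sum>x1\<in>UNIV. J x1 z x) = (\<Sum>x2\<in>UNIV. J x z x2)"
  obtains e U where "0 < e" "\<And>x z. is_pmf (U x z)"
    "\<And>z x2. (\<Sum>x1\<in>UNIV. w x1 z * U x1 z x2) = w x2 z"
    "\<And>x1 z x2. x1 \<noteq> x2 \<Longrightarrow> w x1 z * U x1 z x2 = e * J x1 z x2"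
proof -
  define out where "out x z = (\<Sum>x2\<in>UNIV. J x z x2)" for x z
  have out_eq_0: "out x z = 0" if "w x z = 0" for x z using supp[OF that] by (simp add: out_def)
  obtain e where e: "0 < e" "\<And>x z. e * out x z \<le> w x z"
    using finite_positive_scaling[of UNIV "\<lambda>(x, z). w x z" "\<lambda>(x, z). out x z"] w out_eq_0
    by (auto split: prod.splits)
  define U where
    "U x1 z x2 = of_bool (x1 = x2) + e * (J x1 z x2 - out x1 z * of_bool (x1 = x2)) / w x1 z"
    for x1 z x2
  have wU: "w x1 z * U x1 z x2
      = w x1 z * of_bool (x1 = x2) + e * (J x1 z x2 - out x1 z * of_bool (x1 = x2))" for x1 z x2
    by (cases "w x1 z = 0") (simp_all add: U_def supp out_eq_0 field_simps)
  have "0 \<le> U x1 z x2" for x1 z x2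
  proof (cases "w x1 z = 0")
    case False
    have "0 \<le> e * J x1 z x2" using e(1) J by simp
    then have "0 \<le> w x1 z * U x1 z x2"
      using e(2)[of x1 z] by (cases "x1 = x2") (simp_all add: wU right_diff_distrib)
    then show ?thesis using w[of x1 z] False by (simp add: zero_le_mult_iff)
  qed (simp add: U_def)
  moreover have "(\<Sum>x2\<in>UNIV. U x1 z x2) = 1" for x1 z
    by (simp add: U_def sum.distrib sum_subtractf out_def flip: sum_divide_distrib sum_distrib_left)
  ultimately have "is_pmf (U x1 z)" for x1 z by (simp add: is_pmf_def)
  moreover have "(\<Sum>x1\<in>UNIV. w x1 z * U x1 z x2) = w x2 z" for z x2
    by (simp add: wU sum.distrib sum_subtractf circ flip: sum_distrib_left out_def)
  ultimately show thesis using that[of e U] e(1) by (simp add: wU)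
qed

(* Coupling X_2 = X_1 perturbed in the direction of J is admissible whatever the marginals of J, so
   maximality for P gives the inequality without any reference to P. *)
lemma Mmax_circulation_gain_nonneg:
  fixes q :: "'x::finite \<Rightarrow> 'y::finite \<Rightarrow> real"
  assumes V: "V \<in> Mmax q P" and P: "\<And>x. 0 < P x"
    and J: "\<And>x1 z x2. 0 \<le> J x1 z x2"
    and supp: "\<And>x1 z x2. J x1 z x2 \<noteq> 0 \<Longrightarrow> 0 < marg_Yhat V x1 z"
    and circ: "\<And>z x. (\<Sum>x1\<in>UNIV. J x1 z x) = (\<Sum>x2\<in>UNIV. J x z x2)"
  shows "0 \<le> (\<Sum>x1\<in>UNIV. \<Sum>z\<in>UNIV. \<Sum>x2\<in>UNIV. J x1 z x2 * mean_gain q V x1 z x2)"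
proof -
  let ?w = "\<lambda>x z. P x * marg_Yhat V x z"
  have "J x1 z x2 = 0" if "?w x1 z = 0" for x1 z x2
    using supp[of x1 z x2] P[of x1] that by auto
  moreover have "0 \<le> ?w x z" for x z
    using P[of x] marg_Yhat_nonneg[OF Mmax_imp_is_cond_pmf2[OF V], of x z] by simp
  ultimately obtain e U where e: "0 < e" and U: "\<And>x z. is_pmf (U x z)"
      "\<And>z x2. (\<Sum>x1\<in>UNIV. ?w x1 z * U x1 z x2) = ?w x2 z"
    and off_diagonal: "\<And>x1 z x2. x1 \<noteq> x2 \<Longrightarrow> ?w x1 z * U x1 z x2 = e * J x1 z x2"
    using coupling_of_circulation[of ?w J] J circ by blast
  have scaled: "?w x1 z * U x1 z x2 * mean_gain q V x1 z x2
      = e * (J x1 z x2 * mean_gain q V x1 z x2)" for x1 z x2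
    by (cases "x1 = x2") (simp_all add: off_diagonal mult.assoc[of e])
  have "0 \<le> (\<Sum>x1\<in>UNIV. \<Sum>z\<in>UNIV. \<Sum>x2\<in>UNIV. ?w x1 z * U x1 z x2 * mean_gain q V x1 z x2)"
    using V U unfolding Mmax_iff by blast
  also have "\<dots> = e * (\<Sum>x1\<in>UNIV. \<Sum>z\<in>UNIV. \<Sum>x2\<in>UNIV. J x1 z x2 * mean_gain q V x1 z x2)"
    by (simp only: scaled sum_distrib_left)
  finally show ?thesis using e by (simp add: zero_le_mult_iff)
qed

lemma diagonal_in_Mmax:
  fixes q :: "'x::finite \<Rightarrow> 'y::finite \<Rightarrow> real"
  assumes "is_channel W"
  defines "V \<equiv> \<lambda>x y z. W x y * of_bool (z = y)"
  shows "V \<in> Mmax q P" and "marg_Y V = W" and "marg_Yhat V = W"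
proof -
  show "marg_Y V = W" and marg_Yhat: "marg_Yhat V = W"
    by (simp_all add: marg_Y_def marg_Yhat_def V_def fun_eq_iff)
  have V: "is_cond_pmf2 V"
    using assms(1) by (simp add: is_cond_pmf2_def is_channel_def is_pmf_def V_def)
  have "(\<Sum>x1\<in>UNIV. \<Sum>z\<in>UNIV. \<Sum>x2\<in>UNIV. P x1 * W x1 z * U x1 z x2 * mean_gain q V x1 z x2) = 0"
    if U: "\<And>x1 z. is_pmf (U x1 z)"
      and marginal: "\<And>z x2. (\<Sum>x1\<in>UNIV. P x1 * W x1 z * U x1 z x2) = P x2 * W x2 z" for U
  proof -
    have gain: "W x1 z * mean_gain q V x1 z x2 = W x1 z * (q x2 z - q x1 z)" for x1 z x2
    proof -
      have "W x1 z * mean_gain q V x1 z x2 = (\<Sum>y\<in>UNIV. V x1 y z * (q x2 y - q x1 y))"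
        using marg_Yhat_times_mean_gain[OF V] by (simp only: marg_Yhat)
      then show ?thesis by (simp add: V_def mult.assoc mult.left_commute[of _ "of_bool _"])
    qed
    have "(\<Sum>x1\<in>UNIV. \<Sum>x2\<in>UNIV. P x1 * W x1 z * U x1 z x2 * mean_gain q V x1 z x2) = 0" for z
    proof -
      have "(\<Sum>x1\<in>UNIV. \<Sum>x2\<in>UNIV. P x1 * W x1 z * U x1 z x2 * mean_gain q V x1 z x2)
          = (\<Sum>x1\<in>UNIV. \<Sum>x2\<in>UNIV. P x1 * U x1 z x2 * (W x1 z * mean_gain q V x1 z x2))"
        by (simp only: mult_ac)
      also have "\<dots> = (\<Sum>x1\<in>UNIV. \<Sum>x2\<in>UNIV. P x1 * W x1 z * U x1 z x2 * q x2 z)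
          - (\<Sum>x1\<in>UNIV. P x1 * W x1 z * q x1 z * (\<Sum>x2\<in>UNIV. U x1 z x2))"
        by (simp add: gain sum_distrib_left algebra_simps flip: sum_subtractf)
      also have "(\<Sum>x1\<in>UNIV. \<Sum>x2\<in>UNIV. P x1 * W x1 z * U x1 z x2 * q x2 z)
          = (\<Sum>x2\<in>UNIV. P x2 * W x2 z * q x2 z)"
        by (subst sum.swap) (simp add: marginal flip: sum_distrib_right)
      finally show ?thesis using U by (simp add: is_pmf_def)
    qed
    then show ?thesis by (subst sum.swap) simp
  qed
  then show "V \<in> Mmax q P" unfolding Mmax_iff marg_Yhat using V by simp
qed

section \<open>Confusable codewords\<close>

lemma block_expect_marg_Y:
  assumes "is_cond_pmf2 V"
  shows "block_expect (marg_Y V) xs F =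
    block_expect (marg_Yhat V) xs (\<lambda>zs. block_expect (cond_Y V) (zip xs zs) F)"
proof (induction xs arbitrary: F)
  case (Cons x xs)
  let ?E = "\<lambda>y. block_expect (marg_Y V) xs (\<lambda>ys. F (y # ys))"
  have "block_expect (marg_Yhat V) (x # xs) (\<lambda>zs. block_expect (cond_Y V) (zip (x # xs) zs) F)
      = (\<Sum>z\<in>UNIV. \<Sum>y\<in>UNIV. marg_Yhat V x z * (cond_Y V (x, z) y * ?E y))"
    by (simp add: block_expect_Cons block_expect_sum block_expect_cmult sum_distrib_left
        flip: Cons.IH)
  also have "\<dots> = (\<Sum>z\<in>UNIV. \<Sum>y\<in>UNIV. V x y z * ?E y)"
    by (simp add: marg_Yhat_times_cond_Y[OF assms] flip: mult.assoc)
  also have "\<dots> = (\<Sum>y\<in>UNIV. marg_Y V x y * ?E y)"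
    by (subst sum.swap) (simp add: marg_Y_def sum_distrib_right)
  finally show ?case by (simp add: block_expect_Cons)
qed simp

lemma is_channel_on_cond_Y:
  assumes "is_cond_pmf2 V" "length xs = length zs" "Wn (marg_Yhat V) (length zs) xs zs \<noteq> 0"
  shows "is_channel_on (set (zip xs zs)) (cond_Y V)"
  unfolding is_channel_on_def
proof
  fix p assume "p \<in> set (zip xs zs)"
  then obtain i where i: "i < length zs" "p = (xs ! i, zs ! i)" by (auto simp: set_zip)
  then have "0 < marg_Yhat V (xs ! i) (zs ! i)"
    using assms(3) marg_Yhat_nonneg[OF assms(1)] by (auto simp: Wn_def less_le)
  then show "is_pmf (cond_Y V p)" using is_pmf_cond_Y[OF assms(1)] i(2) by simp
qed

lemma sum_nth_eq_if_mset_zip_eq: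
  fixes f :: "'a \<times> 'b \<Rightarrow> 'c::comm_monoid_add"
  assumes "mset (zip xs zs) = mset (zip xs' zs)" "length xs = length zs" "length xs' = length zs"
  shows "(\<Sum>i<length zs. f (xs ! i, zs ! i)) = (\<Sum>i<length zs. f (xs' ! i, zs ! i))"
proof -
  have "(\<Sum>p\<leftarrow>zip xs zs. f p) = (\<Sum>p\<leftarrow>zip xs' zs. f p)"
    using arg_cong[OF assms(1), of "\<lambda>M. \<Sum>p\<in>#M. f p"]
    by (simp only: mset_map[symmetric] sum_mset_sum_list)
  then show ?thesis using assms(2,3) by (simp add: sum_list_sum_nth atLeast0LessThan)
qed

lemma sum_mean_gain_nonneg:
  fixes q :: "'x::finite \<Rightarrow> 'y::finite \<Rightarrow> real"
  assumes V: "V \<in> Mmax q P" and P: "\<And>x. 0 < P x"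
    and len: "length xs = length zs" "length xs' = length zs"
    and joint_type: "mset (zip xs' zs) = mset (zip xs zs)"
    and supp: "Wn (marg_Yhat V) (length zs) xs zs \<noteq> 0"
  shows "0 \<le> (\<Sum>i<length zs. mean_gain q V (xs ! i) (zs ! i) (xs' ! i))"
proof -
  define t where "t i = (xs ! i, zs ! i, xs' ! i)" for i
  define J where "J x1 z x2 = (\<Sum>i<length zs. of_bool (t i = (x1, z, x2)) :: real)" for x1 z x2
  have "0 < marg_Yhat V x1 z" if J_pos: "J x1 z x2 \<noteq> 0" for x1 z x2
  proof -
    have "\<exists>i<length zs. t i = (x1, z, x2)"
      by (rule ccontr) (use J_pos in \<open>simp add: J_def\<close>)
    then obtain i where "i < length zs" "t i = (x1, z, x2)" by blast
    then show ?thesis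
      using supp marg_Yhat_nonneg[OF Mmax_imp_is_cond_pmf2[OF V]]
      by (auto simp: t_def Wn_def less_le)
  qed
  moreover have "(\<Sum>x1\<in>UNIV. J x1 z x) = (\<Sum>x2\<in>UNIV. J x z x2)" for z x
  proof -
    have "(\<Sum>i<length zs. of_bool (xs' ! i = x \<and> zs ! i = z))
        = (\<Sum>i<length zs. of_bool (xs ! i = x \<and> zs ! i = z) :: real)"
      using sum_nth_eq_if_mset_zip_eq[OF joint_type len(2,1), of "\<lambda>p. of_bool (p = (x, z))"]
      by (simp del: sum_of_bool_eq)
    moreover have
      "(\<Sum>x1\<in>UNIV. of_bool (t i = (x1, z, x))) = (of_bool (xs' ! i = x \<and> zs ! i = z) :: real)"
      "(\<Sum>x2\<in>UNIV. of_bool (t i = (x, z, x2))) = (of_bool (xs ! i = x \<and> zs ! i = z) :: real)" for i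
      by (cases "zs ! i = z"; simp add: t_def)+
    ultimately show ?thesis
      unfolding J_def by (subst (1 2) sum.swap) simp
  qed
  ultimately have "0 \<le> (\<Sum>x1\<in>UNIV. \<Sum>z\<in>UNIV. \<Sum>x2\<in>UNIV. J x1 z x2 * mean_gain q V x1 z x2)"
    by (intro Mmax_circulation_gain_nonneg[OF V P]) (simp add: J_def)
  also have "\<dots> = (\<Sum>(x1, z, x2)\<in>UNIV. J x1 z x2 * mean_gain q V x1 z x2)"
    by (simp add: sum.cartesian_product UNIV_Times_UNIV[symmetric] del: UNIV_Times_UNIV)
  also have "\<dots> = (\<Sum>p\<in>UNIV. \<Sum>i<length zs.
      of_bool (t i = p) * (case p of (x1, z, x2) \<Rightarrow> mean_gain q V x1 z x2))"
    by (intro sum.cong refl)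
      (auto simp: J_def sum_distrib_right simp del: sum_of_bool_eq sum_of_bool_mult_eq)
  also have "\<dots> = (\<Sum>i<length zs. mean_gain q V (xs ! i) (zs ! i) (xs' ! i))"
    by (subst sum.swap) (simp add: t_def)
  finally show ?thesis .
qed

definition confusion_bound :: "('x \<Rightarrow> 'y::finite \<Rightarrow> real) \<Rightarrow> ('x \<Rightarrow> 'y \<Rightarrow> 'y \<Rightarrow> real) \<Rightarrow> real \<Rightarrow> bool" where
  "confusion_bound q V c \<longleftrightarrow>
    (\<forall>xs xs' zs. length xs = length zs \<longrightarrow> length xs' = length zs \<longrightarrow>
      mset (zip xs' zs) = mset (zip xs zs) \<longrightarrow> Wn (marg_Yhat V) (length zs) xs zs \<noteq> 0 \<longrightarrow>
      c \<le> block_prob (cond_Y V) (zip xs zs) {ys. qn q (length zs) xs ys \<le> qn q (length zs) xs' ys})"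

lemma Mmax_confusion_bound:
  fixes q :: "'x::finite \<Rightarrow> 'y::finite \<Rightarrow> real"
  assumes V: "V \<in> Mmax q P" and P: "\<And>x. 0 < P x"
  obtains c where "0 < c" "confusion_bound q V c"
proof -
  define K where "K = (\<lambda>(x, z, x' :: 'x). cond_Y V (x, z))"
  define g where "g = (\<lambda>(x, z :: 'y, x') y. q x' y - q x y)"
  obtain c where c: "0 < c" "\<And>as. is_channel_on (set as) K \<Longrightarrow>
      0 \<le> (\<Sum>a\<leftarrow>as. letter_expect K g a) \<Longrightarrow> c \<le> block_prob K as {ys. 0 \<le> qn g (length as) as ys}"
    using uniform_block_prob_qn_nonneg[of K g] by blast
  have "confusion_bound q V c"
    unfolding confusion_bound_def
  proof (intro allI impI)
    fix xs xs' zs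
    assume len: "length xs = length zs" "length xs' = length zs"
      and joint_type: "mset (zip xs' zs) = mset (zip xs zs)"
      and supp: "Wn (marg_Yhat V) (length zs) xs zs \<noteq> 0"
    let ?as = "zip xs (zip zs xs')"
    have "is_channel_on (set (zip xs zs)) (cond_Y V)"
      by (rule is_channel_on_cond_Y[OF Mmax_imp_is_cond_pmf2[OF V] len(1) supp])
    then have "is_channel_on (set ?as) K"
      using len by (fastforce simp: is_channel_on_def K_def set_zip)
    moreover have "0 \<le> (\<Sum>a\<leftarrow>?as. letter_expect K g a)"
      using sum_mean_gain_nonneg[OF V P len joint_type supp] len
      by (simp add: sum_list_sum_nth atLeast0LessThan letter_expect_def mean_gain_def K_def g_def)
    ultimately have "c \<le> block_prob K ?as {ys. 0 \<le> qn g (length ?as) ?as ys}" by (rule c(2))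
    also have "\<dots> = block_prob (cond_Y V) (zip xs zs)
        {ys. qn q (length zs) xs ys \<le> qn q (length zs) xs' ys}"
      using len unfolding block_prob_def
      by (intro block_expect_cong) (auto simp: K_def g_def qn_def sum_subtractf indicator_def)
    finally show "c \<le> block_prob (cond_Y V) (zip xs zs)
        {ys. qn q (length zs) xs ys \<le> qn q (length zs) xs' ys}" .
  qed
  with c(1) show thesis by (rule that)
qed

definition error_outputs :: "('x \<Rightarrow> 'y \<Rightarrow> real) \<Rightarrow> nat \<Rightarrow> 'x list list \<Rightarrow> nat \<Rightarrow> 'y list set" where
  "error_outputs q n C m = {ys. \<exists>m'<length C. m' \<noteq> m \<and> qn q n (C ! m) ys \<le> qn q n (C ! m') ys}"

lemma Pe_eq_sum_block_prob:
  assumes "is_codebook n C"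
  shows "Pe q W n C = (\<Sum>m<length C. block_prob W (C ! m) (error_outputs q n C m)) / length C"
proof -
  have "block_prob W (C ! m) (error_outputs q n C m) = (\<Sum>ys | length ys = n.
      if \<exists>m'<length C. m' \<noteq> m \<and> qn q n (C ! m') ys \<ge> qn q n (C ! m) ys
      then Wn W n (C ! m) ys else 0)"
    if "m < length C" for m
    using assms that unfolding block_prob_def block_expect_def error_outputs_def is_codebook_def
    by (intro sum.cong) (auto simp: indicator_def)
  then show ?thesis by (simp add: Pe_def)
qed

lemma block_prob_error_outputs_ge_if_not_isolated:
  assumes V: "is_cond_pmf2 V" and c: "confusion_bound q V c"
    and C: "is_codebook n C" and m: "m < length C" and zs: "length zs = n"
    and supp: "Wn (marg_Yhat V) n (C ! m) zs \<noteq> 0" and "\<not> isolated C m zs"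
  shows "c \<le> block_prob (cond_Y V) (zip (C ! m) zs) (error_outputs q n C m)"
proof -
  obtain m' where m': "m' < length C" "m' \<noteq> m" "mset (zip (C ! m') zs) = mset (zip (C ! m) zs)"
    using assms(7) by (auto simp: isolated_def)
  have len: "length (C ! m) = n" "length (C ! m') = n"
    using C m m'(1) by (auto simp: is_codebook_def)
  have posterior: "is_channel_on (set (zip (C ! m) zs)) (cond_Y V)"
    using is_channel_on_cond_Y[OF V] len(1) zs supp by simp
  have "c \<le> block_prob (cond_Y V) (zip (C ! m) zs) {ys. qn q n (C ! m) ys \<le> qn q n (C ! m') ys}"
    using c[unfolded confusion_bound_def, rule_format,
        where xs = "C ! m" and xs' = "C ! m'" and zs = zs] m'(3) len zs supp by simp
  also have "\<dots> \<le> block_prob (cond_Y V) (zip (C ! m) zs) (error_outputs q n C m)"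
    using m' by (intro block_prob_mono[OF posterior]) (auto simp: error_outputs_def)
  finally show ?thesis .
qed

lemma block_prob_error_outputs_ge:
  assumes V: "is_cond_pmf2 V" and c: "confusion_bound q V c"
    and C: "is_codebook n C" and m: "m < length C"
  shows "c * (1 - block_prob (marg_Yhat V) (C ! m) {zs. isolated C m zs})
    \<le> block_prob (marg_Y V) (C ! m) (error_outputs q n C m)"
proof -
  let ?H = "marg_Yhat V" and ?xs = "C ! m" and ?err = "error_outputs q n C m"
  have channel: "is_channel_on (set ?xs) ?H"
    by (intro is_channel_imp_is_channel_on is_channel_marg_Yhat V)
  have len: "length ?xs = n" using C m by (simp add: is_codebook_def)
  have "c * (1 - block_prob ?H ?xs {zs. isolated C m zs})
      = block_expect ?H ?xs (\<lambda>zs. c * (1 - indicator {zs. isolated C m zs} zs))"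
    by (simp only: block_expect_cmult block_expect_diff block_expect_const[OF channel]
        block_prob_def)
  also have "\<dots> \<le> block_expect ?H ?xs (\<lambda>zs. block_prob (cond_Y V) (zip ?xs zs) ?err)"
  proof (rule block_expect_mono[OF channel])
    fix zs :: "'b list"
    assume zs: "length zs = length ?xs" and supp: "Wn ?H (length ?xs) ?xs zs \<noteq> 0"
    show "c * (1 - indicator {zs. isolated C m zs} zs) \<le> block_prob (cond_Y V) (zip ?xs zs) ?err"
    proof (cases "isolated C m zs")
      case True
      have "is_channel_on (set (zip ?xs zs)) (cond_Y V)"
        using is_channel_on_cond_Y[OF V] zs supp by simp
      then show ?thesis using True by (simp add: block_prob_nonneg)
    next
      case False
      then show ?thesis
        using block_prob_error_outputs_ge_if_not_isolated[OF V c C m] zs supp len by simp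
    qed
  qed
  also have "\<dots> = block_prob (marg_Y V) ?xs ?err"
    by (simp add: block_prob_def block_expect_marg_Y[OF V])
  finally show ?thesis .
qed

section \<open>Divergence and mutual information\<close>

(* For v absolutely continuous with respect to Q; a letter with v y > 0 = Q y contributes
   v y * log 2 0 = 0 rather than infinity. *)
definition divergence :: "('y::finite \<Rightarrow> real) \<Rightarrow> ('y \<Rightarrow> real) \<Rightarrow> real" where
  "divergence v Q = (\<Sum>y\<in>UNIV. v y * log 2 (v y / Q y))"

definition output_pmf :: "('x::finite \<Rightarrow> real) \<Rightarrow> ('x \<Rightarrow> 'y \<Rightarrow> real) \<Rightarrow> 'y \<Rightarrow> real" where
  "output_pmf P V y = (\<Sum>x\<in>UNIV. P x * V x y)"

lemma log2_le_minus_one: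
  assumes "0 < t"
  shows "log 2 t \<le> (t - 1) / ln 2"
  using ln_le_minus_one[OF assms] by (simp add: log_def divide_right_mono)

lemma divergence_nonneg:
  assumes v: "is_pmf v" and Q: "is_pmf Q" and ac: "\<And>y. 0 < v y \<Longrightarrow> 0 < Q y"
  shows "0 \<le> divergence v Q"
proof -
  have "(\<Sum>y\<in>UNIV. (v y - Q y) / ln 2) \<le> divergence v Q"
    unfolding divergence_def
  proof (rule sum_mono)
    fix y
    show "(v y - Q y) / ln 2 \<le> v y * log 2 (v y / Q y)"
    proof (cases "v y = 0")
      case True
      then show ?thesis using Q by (simp add: is_pmf_def)
    next
      case False
      then have pos: "0 < v y" "0 < Q y" using v ac[of y] by (simp_all add: is_pmf_def less_le)
      have "v y * log 2 (Q y / v y) \<le> v y * ((Q y / v y - 1) / ln 2)"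
        using pos by (intro mult_left_mono log2_le_minus_one) auto
      also have "\<dots> = (Q y - v y) / ln 2" using pos by (simp add: field_simps)
      finally show ?thesis using pos by (simp add: log_divide field_simps)
    qed
  qed
  moreover have "(\<Sum>y\<in>UNIV. (v y - Q y) / ln 2) = 0"
    using v Q by (simp add: is_pmf_def sum_subtractf flip: sum_divide_distrib)
  ultimately show ?thesis by simp
qed

lemma mutual_info_eq_divergence:
  "mutual_info P V = (\<Sum>x\<in>UNIV. P x * divergence (V x) (output_pmf P V))"
  unfolding mutual_info_def divergence_def output_pmf_def sum_distrib_left
  by (intro sum.cong refl) auto

lemma is_pmf_output_pmf:
  assumes "is_pmf P" "is_channel V"
  shows "is_pmf (output_pmf P V)"
proof -
  have "(\<Sum>y\<in>UNIV. \<Sum>x\<in>UNIV. P x * V x y) = 1"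
    using assms by (subst sum.swap) (simp add: is_pmf_def is_channel_def flip: sum_distrib_left)
  then show ?thesis using assms
    by (auto simp: is_pmf_def output_pmf_def is_channel_def intro!: sum_nonneg)
qed

lemma output_pmf_ge:
  assumes "is_pmf P" "is_channel V"
  shows "P x * V x y \<le> output_pmf P V y"
  unfolding output_pmf_def using assms
  by (intro member_le_sum[of x UNIV "\<lambda>x. P x * V x y"]) (auto simp: is_pmf_def is_channel_def)

lemma output_pmf_pos:
  assumes "is_pmf P" "is_channel V" "0 < P x" "0 < V x y"
  shows "0 < output_pmf P V y"
  using output_pmf_ge[OF assms(1,2), of x y] mult_pos_pos[OF assms(3,4)] by linarith

lemma divergence_output_nonneg:
  assumes "is_pmf P" "is_channel V" "0 < P x"
  shows "0 \<le> divergence (V x) (output_pmf P V)"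
  using assms
  by (intro divergence_nonneg is_pmf_output_pmf output_pmf_pos) (auto simp: is_channel_def)

lemma mutual_info_nonneg:
  assumes "is_pmf P" "is_channel V"
  shows "0 \<le> mutual_info P V"
  unfolding mutual_info_eq_divergence
proof (rule sum_nonneg)
  fix x
  have "0 \<le> P x" using assms(1) by (simp add: is_pmf_def)
  then show "0 \<le> P x * divergence (V x) (output_pmf P V)"
    using divergence_output_nonneg[OF assms, of x] by (cases "P x = 0") auto
qed

lemma mutual_info_le:
  fixes P :: "'x::finite \<Rightarrow> real"
  assumes P: "is_pmf P" and V: "is_channel V"
  shows "mutual_info P V \<le> CARD('x) / ln 2"
proof -
  have "mutual_info P V \<le> (\<Sum>x\<in>(UNIV::'x set). \<Sum>y\<in>UNIV. V x y / ln 2)"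
    unfolding mutual_info_eq_divergence divergence_def sum_distrib_left
  proof (intro sum_mono)
    fix x y
    let ?Q = "output_pmf P V y"
    have nonneg: "0 \<le> P x" "0 \<le> V x y" using P V by (auto simp: is_pmf_def is_channel_def)
    show "P x * (V x y * log 2 (V x y / ?Q)) \<le> V x y / ln 2"
    proof (cases "P x = 0 \<or> V x y = 0")
      case False
      then have pos: "0 < P x" "0 < V x y" using nonneg by auto
      have Q: "0 < ?Q" "P x * V x y \<le> ?Q"
        using output_pmf_pos[OF P V pos] output_pmf_ge[OF P V] by auto
      have "log 2 (V x y / ?Q) \<le> (V x y / ?Q - 1) / ln 2"
        using pos Q(1) by (intro log2_le_minus_one) simp
      also have "\<dots> \<le> V x y / ?Q / ln 2" by (intro divide_right_mono) auto
      finally have "log 2 (V x y / ?Q) \<le> V x y / ?Q / ln 2" .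
      then have "P x * (V x y * log 2 (V x y / ?Q)) \<le> P x * (V x y * (V x y / ?Q / ln 2))"
        using pos by (intro mult_left_mono) auto
      also have "\<dots> = P x * V x y / ?Q * (V x y / ln 2)" by simp
      also have "\<dots> \<le> 1 * (V x y / ln 2)" using pos Q by (intro mult_right_mono) auto
      finally show ?thesis by simp
    qed (use nonneg in auto)
  qed
  also have "\<dots> = CARD('x) / ln 2"
    using V by (simp add: is_channel_def is_pmf_def flip: sum_divide_distrib)
  finally show ?thesis .
qed

section \<open>Change of measure\<close>

definition log_ratio :: "('x \<Rightarrow> 'y \<Rightarrow> real) \<Rightarrow> ('y \<Rightarrow> real) \<Rightarrow> 'x \<Rightarrow> 'y \<Rightarrow> real" where
  "log_ratio V Q x y = log 2 (V x y / Q y)"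

lemma letter_expect_log_ratio: "letter_expect V (log_ratio V Q) x = divergence (V x) Q"
  by (simp add: letter_expect_def log_ratio_def divergence_def)

lemma Wn_eq_powr_log_ratio:
  assumes V: "is_channel V" and ac: "\<forall>x y. 0 < V x y \<longrightarrow> 0 < Q y" and "Wn V n xs zs \<noteq> 0"
  shows "Wn V n xs zs = 2 powr qn (log_ratio V Q) n xs zs * Wn (\<lambda>_. Q) n xs zs"
proof -
  have "V (xs ! i) (zs ! i) = 2 powr log_ratio V Q (xs ! i) (zs ! i) * Q (zs ! i)" if "i < n" for i
  proof -
    have "0 < V (xs ! i) (zs ! i)"
      using assms(3) V that by (auto simp: Wn_def is_channel_def is_pmf_def less_le)
    then show ?thesis using ac[rule_format, of "xs ! i" "zs ! i"] by (simp add: log_ratio_def)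
  qed
  then show ?thesis by (simp add: Wn_def qn_def prod.distrib powr_sum)
qed

lemma block_prob_change_of_measure:
  assumes V: "is_channel V" and Q: "is_pmf Q" and ac: "\<forall>x y. 0 < V x y \<longrightarrow> 0 < Q y"
  shows "block_prob V xs A \<le> 2 powr \<tau> * block_prob (\<lambda>_. Q) xs A
    + block_prob V xs {zs. \<tau> \<le> qn (log_ratio V Q) (length xs) xs zs}"
  unfolding block_prob_def block_expect_def sum_distrib_left sum.distrib[symmetric]
proof (rule sum_mono)
  fix zs :: "'b list"
  let ?p = "Wn V (length xs) xs zs" and ?p' = "Wn (\<lambda>_. Q) (length xs) xs zs"
  let ?S = "qn (log_ratio V Q) (length xs) xs zs"
  have nonneg: "0 \<le> ?p" "0 \<le> ?p'"
    using V Q by (auto intro: Wn_nonneg is_channel_imp_is_channel_on is_pmf_imp_is_channel_on)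
  have "?p \<le> 2 powr \<tau> * ?p'" if "?S < \<tau>"
  proof (cases "?p = 0")
    case False
    have "?p = 2 powr ?S * ?p'" using False by (intro Wn_eq_powr_log_ratio[OF V ac])
    also have "\<dots> \<le> 2 powr \<tau> * ?p'" using that nonneg by (intro mult_right_mono) auto
    finally show ?thesis .
  qed (use nonneg in simp)
  then show "?p * indicator A zs \<le> 2 powr \<tau> * (?p' * indicator A zs)
      + ?p * indicator {zs. \<tau> \<le> qn (log_ratio V Q) (length xs) xs zs} zs"
    using nonneg by (auto simp: indicator_def not_le)
qed

lemma block_prob_le_of_divergence:
  fixes r \<delta> v :: real
  assumes V: "is_channel V" and Q: "is_pmf Q" and ac: "\<forall>x y. 0 < V x y \<longrightarrow> 0 < Q y"
    and v: "\<And>x y. (centred V (log_ratio V Q) x y)\<^sup>2 \<le> v"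
    and "xs \<noteq> []" "0 < \<delta>" and mean: "(\<Sum>x\<leftarrow>xs. divergence (V x) Q) \<le> length xs * r"
  shows "block_prob V xs A \<le> 2 powr (length xs * (r + \<delta>)) * block_prob (\<lambda>_. Q) xs A
    + v / (length xs * \<delta>\<^sup>2)"
proof -
  define n where "n = real (length xs)"
  have "0 < n" using \<open>xs \<noteq> []\<close> by (simp add: n_def)
  let ?S = "qn (log_ratio V Q) (length xs) xs"
  have channel: "is_channel_on (set xs) V" using V by (rule is_channel_imp_is_channel_on)
  have "block_prob V xs {zs. n * (r + \<delta>) \<le> ?S zs}
      \<le> block_prob V xs {zs. (\<Sum>x\<leftarrow>xs. letter_expect V (log_ratio V Q) x) + n * \<delta> \<le> ?S zs}"
    using mean by (intro block_prob_mono[OF channel])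
      (simp add: letter_expect_log_ratio n_def distrib_left)
  also have "\<dots> \<le> n * v / (n * \<delta>)\<^sup>2"
    unfolding n_def using \<open>0 < n\<close> \<open>0 < \<delta>\<close> v
    by (intro block_prob_deviation_le[OF channel]) (auto simp: n_def)
  also have "\<dots> = v / (n * \<delta>\<^sup>2)"
    using \<open>0 < n\<close> by (simp add: power_mult_distrib power2_eq_square)
  finally have "block_prob V xs {zs. n * (r + \<delta>) \<le> ?S zs} \<le> v / (n * \<delta>\<^sup>2)" .
  moreover have "block_prob V xs A \<le> 2 powr (n * (r + \<delta>)) * block_prob (\<lambda>_. Q) xs A
      + block_prob V xs {zs. n * (r + \<delta>) \<le> ?S zs}"
    by (rule block_prob_change_of_measure[OF V Q ac])
  ultimately show ?thesis by (simp add: n_def)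
qed

section \<open>Dominated compositions\<close>

definition dominated_by :: "real \<Rightarrow> ('x \<Rightarrow> real) \<Rightarrow> 'x list \<Rightarrow> bool" where
  "dominated_by \<eta> P xs \<longleftrightarrow> (\<forall>x. real (count_list xs x) \<le> (1 + \<eta>) * length xs * P x)"

definition normalised :: "('x::finite \<Rightarrow> real) \<Rightarrow> 'x \<Rightarrow> real" where
  "normalised f x = f x / (\<Sum>x\<in>UNIV. f x)"

lemma normalised_pos:
  fixes f :: "'x::finite \<Rightarrow> real"
  assumes "\<And>x. 0 < f x"
  shows "0 < normalised f x"
  using assms by (simp add: normalised_def sum_pos)

lemma is_pmf_normalised:
  fixes f :: "'x::finite \<Rightarrow> real"
  assumes "\<And>x. 0 < f x"
  shows "is_pmf (normalised f)"
proof -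
  have "0 < (\<Sum>x\<in>UNIV. f x)" using assms by (simp add: sum_pos)
  then have "(\<Sum>x\<in>UNIV. normalised f x) = 1"
    by (simp add: normalised_def flip: sum_divide_distrib)
  then show ?thesis using normalised_pos[of f] assms by (simp add: is_pmf_def less_imp_le)
qed

lemma dominated_by_normalised:
  fixes f :: "'x::finite \<Rightarrow> real" and k \<eta> :: real
  assumes "0 < k" "\<And>x. 0 < f x" "\<And>x. k * count_list xs x \<le> length xs * f x"
    and total: "(\<Sum>x\<in>UNIV. f x) \<le> k * (1 + \<eta>)"
  shows "dominated_by \<eta> (normalised f) xs"
  unfolding dominated_by_def
proof
  fix x
  have "0 < (\<Sum>x\<in>UNIV. f x)" using assms(2) by (simp add: sum_pos)
  then have "f x = (\<Sum>x\<in>UNIV. f x) * normalised f x" by (simp add: normalised_def)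
  also have "\<dots> \<le> k * (1 + \<eta>) * normalised f x"
    using total normalised_pos[of f x] assms(2) by (intro mult_right_mono) auto
  finally have f_le: "f x \<le> k * (1 + \<eta>) * normalised f x" .
  have "k * count_list xs x \<le> length xs * f x" by (rule assms(3))
  also have "\<dots> \<le> length xs * (k * (1 + \<eta>) * normalised f x)"
    using f_le by (rule mult_left_mono) simp
  also have "\<dots> = k * ((1 + \<eta>) * length xs * normalised f x)" by (simp only: mult_ac)
  finally show "count_list xs x \<le> (1 + \<eta>) * length xs * normalised f x" using assms(1) by simp
qed

definition rounded_counts :: "nat \<Rightarrow> 'x list \<Rightarrow> 'x \<Rightarrow> nat" where
  "rounded_counts k xs x = k * count_list xs x div length xs + 1"

lemma rounded_counts_le: "rounded_counts k xs x \<le> k + 1"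
proof -
  have "k * count_list xs x \<le> k * length xs" by (simp add: count_le_length)
  then have "k * count_list xs x div length xs \<le> k * length xs div length xs" by (rule div_le_mono)
  also have "\<dots> \<le> k" by (cases "xs = []") simp_all
  finally show ?thesis by (simp add: rounded_counts_def)
qed

lemma dominated_by_rounded_counts:
  fixes xs :: "'x::finite list" and \<eta> :: real
  assumes "0 < k" and k: "CARD('x) \<le> k * \<eta>"
  shows "dominated_by \<eta> (normalised (\<lambda>x. real (rounded_counts k xs x))) xs"
proof (rule dominated_by_normalised)
  show "0 < real k" and "\<And>x. 0 < real (rounded_counts k xs x)"
    using assms(1) by (simp_all add: rounded_counts_def)
  fix x
  have "k * count_list xs x \<le> length xs * rounded_counts k xs x"
  proof (cases "xs = []")
    case False
    then show ?thesis
      using dividend_less_times_div[of "length xs" "k * count_list xs x"]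
      by (simp add: rounded_counts_def)
  qed simp
  then show "real k * count_list xs x \<le> length xs * real (rounded_counts k xs x)"
    by (metis of_nat_le_iff of_nat_mult)
next
  have "real (rounded_counts k xs x) \<le> k * count_list xs x / length xs + 1" for x
    using of_nat_div_le_of_nat[of "k * count_list xs x" "length xs", where ?'a = real]
    by (simp add: rounded_counts_def)
  then have "(\<Sum>x\<in>UNIV. real (rounded_counts k xs x))
      \<le> (\<Sum>x\<in>UNIV. k * count_list xs x / length xs + 1)"
    by (intro sum_mono) auto
  also have "\<dots> = real k * (\<Sum>x\<in>UNIV. count_list xs x) / length xs + CARD('x)"
    by (simp add: sum.distrib sum_distrib_left sum_divide_distrib)
  also have "\<dots> \<le> k + CARD('x)" by (simp add: sum_count_set)
  finally show "(\<Sum>x\<in>UNIV. real (rounded_counts k xs x)) \<le> k * (1 + \<eta>)"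
    using k by (simp add: distrib_left)
qed

lemma finite_dominating_pmfs:
  fixes \<eta> :: real
  assumes "0 < \<eta>"
  obtains F :: "('x::finite \<Rightarrow> real) set" where "finite F" "\<And>P. P \<in> F \<Longrightarrow> is_pmf P"
    "\<And>P x. P \<in> F \<Longrightarrow> 0 < P x" "\<And>xs. \<exists>P\<in>F. dominated_by \<eta> P xs"
proof -
  obtain k :: nat where k: "CARD('x) / \<eta> < k" using reals_Archimedean2 by blast
  moreover have "0 < CARD('x) / \<eta>" using assms by simp
  ultimately have "0 < real k" by (rule less_trans[rotated])
  then have "0 < k" by simp
  define G where "G a = normalised (\<lambda>x. real (a x))" for a :: "'x \<Rightarrow> nat"
  define F where "F = G ` (UNIV \<rightarrow>\<^sub>E {1..k + 1})"
  have "is_pmf P \<and> (\<forall>x. 0 < P x)" if P: "P \<in> F" for P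
  proof -
    obtain a where a: "a \<in> UNIV \<rightarrow>\<^sub>E {1..k + 1}" "P = G a" using P by (auto simp: F_def)
    then have "0 < real (a x)" for x using PiE_mem[OF a(1), of x] by simp
    then show ?thesis unfolding a(2) G_def by (simp add: is_pmf_normalised normalised_pos)
  qed
  moreover have "\<exists>P\<in>F. dominated_by \<eta> P xs" for xs :: "'x list"
  proof
    show "G (rounded_counts k xs) \<in> F"
      using rounded_counts_le[of k xs] unfolding F_def
      by (intro imageI PiE_I) (auto simp: rounded_counts_def)
    show "dominated_by \<eta> (G (rounded_counts k xs)) xs"
      unfolding G_def using k assms \<open>0 < k\<close>
      by (intro dominated_by_rounded_counts) (simp_all add: field_simps)
  qed
  moreover have "finite F" unfolding F_def by (intro finite_imageI finite_PiE) auto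
  ultimately show thesis using that[of F] by blast
qed

definition dominated_messages :: "real \<Rightarrow> ('x \<Rightarrow> real) \<Rightarrow> 'x list list \<Rightarrow> nat set" where
  "dominated_messages \<eta> P C = {m. m < length C \<and> dominated_by \<eta> P (C ! m)}"

definition many_dominated :: "real \<Rightarrow> ('x \<Rightarrow> real) \<Rightarrow> nat \<Rightarrow> 'x list list \<Rightarrow> bool" where
  "many_dominated \<eta> P N C \<longleftrightarrow> length C \<le> card (dominated_messages \<eta> P C) * N"

lemma ex_many_dominated:
  assumes "finite F" and dom: "\<And>xs. \<exists>P\<in>F. dominated_by \<eta> P xs"
  shows "\<exists>P\<in>F. many_dominated \<eta> P (card F) C"
proof -
  have "\<forall>m. \<exists>P. P \<in> F \<and> dominated_by \<eta> P (C ! m)" using dom by blast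
  from choice[OF this] obtain p where p: "\<And>m. p m \<in> F" "\<And>m. dominated_by \<eta> (p m) (C ! m)"
    by blast
  have "p \<in> {..<length C} \<rightarrow> F" "F \<noteq> {}" using p(1) by auto
  then obtain P where P: "P \<in> F" "card {..<length C} \<le> card (p -` {P} \<inter> {..<length C}) * card F"
    using pigeonhole_card[of p "{..<length C}" F] assms(1) by blast
  have "length C \<le> card (p -` {P} \<inter> {..<length C}) * card F" using P(2) by simp
  also have "\<dots> \<le> card (dominated_messages \<eta> P C) * card F"
    using p(2) by (intro mult_le_mono1 card_mono) (auto simp: dominated_messages_def)
  finally show ?thesis using P(1) unfolding many_dominated_def by blast
qed

lemma sum_list_map_eq_sum_count_list:
  fixes f :: "'a::finite \<Rightarrow> 'b::semiring_1"
  shows "(\<Sum>x\<leftarrow>xs. f x) = (\<Sum>x\<in>UNIV. of_nat (count_list xs x) * f x)"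
proof (induction xs)
  case (Cons a xs)
  have "(\<Sum>x\<in>UNIV. of_nat (count_list (a # xs) x) * f x)
      = (\<Sum>x\<in>UNIV. (if x = a then f x else 0) + of_nat (count_list xs x) * f x)"
    by (intro sum.cong) (auto simp: algebra_simps)
  with Cons show ?case by (simp add: sum.distrib)
qed simp

lemma sum_list_divergence_le:
  assumes P: "is_pmf P" and V: "is_channel V" and pos: "\<And>x. 0 < P x"
    and dom: "dominated_by \<eta> P xs"
  shows "(\<Sum>x\<leftarrow>xs. divergence (V x) (output_pmf P V)) \<le> length xs * ((1 + \<eta>) * mutual_info P V)"
proof -
  have "(\<Sum>x\<leftarrow>xs. divergence (V x) (output_pmf P V))
      \<le> (\<Sum>x\<in>UNIV. (1 + \<eta>) * length xs * P x * divergence (V x) (output_pmf P V))"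
    unfolding sum_list_map_eq_sum_count_list using dom
    by (intro sum_mono mult_right_mono divergence_output_nonneg[OF P V pos])
      (simp add: dominated_by_def)
  also have "\<dots> = length xs * ((1 + \<eta>) * mutual_info P V)"
    by (simp add: mutual_info_eq_divergence sum_distrib_left mult_ac)
  finally show ?thesis .
qed

section \<open>The converse\<close>

lemma ex_Mmax_mutual_info_less:
  fixes W :: "'x::finite \<Rightarrow> 'y::finite \<Rightarrow> real"
  assumes W: "is_channel W" and P: "is_pmf P" and r: "Rbar W q < r"
  shows "\<exists>V. V \<in> Mmax q P \<and> marg_Y V = W \<and> mutual_info P (marg_Yhat V) < r"
proof -
  define S where "S P = {V. V \<in> Mmax q P \<and> marg_Y V = W}" for P
  define f where "f P = (INF V\<in>S P. mutual_info P (marg_Yhat V))" for P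
  have diagonal: "\<exists>V\<in>S P. marg_Yhat V = W" for P
    using diagonal_in_Mmax[OF W] unfolding S_def by blast
  have bdd: "bdd_below ((\<lambda>V. mutual_info P (marg_Yhat V)) ` S P)" if "is_pmf P" for P
    using mutual_info_nonneg[OF that is_channel_marg_Yhat]
    by (intro bdd_belowI[of _ 0]) (auto simp: S_def Mmax_iff)
  have "f P \<le> CARD('x) / ln 2" if "is_pmf P" for P
    using diagonal[of P] cINF_lower[OF bdd[OF that]] mutual_info_le[OF that W]
    unfolding f_def by fastforce
  then have "f P \<le> (SUP P\<in>{P. is_pmf P}. f P)"
    using P by (intro cSUP_upper bdd_aboveI2) auto
  also have "\<dots> = Rbar W q" by (simp add: Rbar_def f_def S_def)
  finally have "(INF V\<in>S P. mutual_info P (marg_Yhat V)) < r" using r by (simp add: f_def)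
  moreover have "S P \<noteq> {}" using diagonal by blast
  ultimately have "\<exists>V\<in>S P. mutual_info P (marg_Yhat V) < r"
    using cINF_less_iff[OF _ bdd[OF P]] by blast
  then show ?thesis by (auto simp: S_def)
qed

lemma polynomial_times_powr_minus_tendsto_0:
  fixes \<delta> :: real
  assumes "0 < \<delta>" "0 < k"
  shows "(\<lambda>n. real ((n + k) ^ k) * 2 powr (- (n * \<delta>))) \<longlonglongrightarrow> 0"
proof -
  define y where "y = (2 :: real) powr (- (\<delta> / k))"
  have y: "norm y < 1" using assms by (simp add: y_def powr_less_one)
  have "(\<lambda>n. (real n * y ^ n + k * y ^ n) ^ k) \<longlonglongrightarrow> (0 + real k * 0) ^ k"
    using y by (intro tendsto_intros powser_times_n_limit_0 LIMSEQ_power_zero)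
  moreover have "(real n * y ^ n + k * y ^ n) ^ k = real ((n + k) ^ k) * 2 powr (- (n * \<delta>))" for n
  proof -
    have "2 powr (- (n * \<delta>)) = (y ^ n) ^ k" using assms(2) by (simp add: y_def powr_power)
    then show ?thesis by (simp add: distrib_right flip: power_mult_distrib)
  qed
  ultimately show ?thesis using assms(2) by (simp add: zero_power)
qed

definition Pe_bounded_below ::
    "('x \<Rightarrow> 'y::finite \<Rightarrow> real) \<Rightarrow> ('x \<Rightarrow> 'y \<Rightarrow> real) \<Rightarrow> real \<Rightarrow> 'x list list set \<Rightarrow> real \<Rightarrow> nat
      \<Rightarrow> bool" where
  "Pe_bounded_below q W R S c n \<longleftrightarrow>
    (\<forall>C\<in>S. is_codebook n C \<longrightarrow> 2 powr (n * R) \<le> length C \<longrightarrow> c \<le> Pe q W n C)"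

locale dominating_pmf =
  fixes q :: "'x::finite \<Rightarrow> 'y::finite \<Rightarrow> real" and V P and c v r \<delta> \<eta> :: real
  assumes V: "is_cond_pmf2 V" and P: "is_pmf P" and P_pos: "0 < P x"
    and c: "0 < c" "confusion_bound q V c"
    and v: "(centred (marg_Yhat V) (log_ratio (marg_Yhat V) (output_pmf P (marg_Yhat V))) x z)\<^sup>2 \<le> v"
    and \<delta>: "0 < \<delta>" and r: "(1 + \<eta>) * mutual_info P (marg_Yhat V) \<le> r"
begin

definition isolated_prob :: "'x list list \<Rightarrow> nat \<Rightarrow> real" where
  "isolated_prob C m =
    block_prob (\<lambda>_. output_pmf P (marg_Yhat V)) (C ! m) {zs. isolated C m zs}"

definition error_prob :: "nat \<Rightarrow> 'x list list \<Rightarrow> nat \<Rightarrow> real" where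
  "error_prob n C m = block_prob (marg_Y V) (C ! m) (error_outputs q n C m)"

abbreviation dominated :: "'x list list \<Rightarrow> nat set" where
  "dominated \<equiv> dominated_messages \<eta> P"

lemma is_channel_Yhat: "is_channel (marg_Yhat V)"
  by (rule is_channel_marg_Yhat[OF V])

lemma is_pmf_output: "is_pmf (output_pmf P (marg_Yhat V))"
  by (rule is_pmf_output_pmf[OF P is_channel_Yhat])

lemma error_prob_ge:
  assumes C: "is_codebook n C" and m: "m \<in> dominated C" and n: "0 < n"
  shows "c * (1 - (2 powr (n * (r + \<delta>)) * isolated_prob C m + v / (n * \<delta>\<^sup>2))) \<le> error_prob n C m"
proof -
  let ?H = "marg_Yhat V" and ?Q = "output_pmf P (marg_Yhat V)" and ?iso = "{zs. isolated C m zs}"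
  have m_less: "m < length C" and dom: "dominated_by \<eta> P (C ! m)"
    using m by (simp_all add: dominated_messages_def)
  have len: "length (C ! m) = n" using C m_less by (simp add: is_codebook_def)
  have ac: "\<forall>x z. 0 < ?H x z \<longrightarrow> 0 < ?Q z" using output_pmf_pos[OF P is_channel_Yhat P_pos] by blast
  have "n * ((1 + \<eta>) * mutual_info P ?H) \<le> n * r" using r by (intro mult_left_mono) auto
  with sum_list_divergence_le[OF P is_channel_Yhat P_pos dom]
  have mean: "(\<Sum>x\<leftarrow>C ! m. divergence (?H x) ?Q) \<le> length (C ! m) * r" by (simp add: len)
  have nonempty: "C ! m \<noteq> []" using len n by auto
  have "block_prob ?H (C ! m) ?iso \<le> 2 powr (n * (r + \<delta>)) * isolated_prob C m + v / (n * \<delta>\<^sup>2)"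
    using block_prob_le_of_divergence[OF is_channel_Yhat is_pmf_output ac v nonempty \<delta> mean]
    by (simp add: len isolated_prob_def)
  then have "c * (1 - (2 powr (n * (r + \<delta>)) * isolated_prob C m + v / (n * \<delta>\<^sup>2)))
      \<le> c * (1 - block_prob ?H (C ! m) ?iso)"
    using c(1) by (intro mult_left_mono) auto
  also have "\<dots> \<le> error_prob n C m"
    unfolding error_prob_def by (rule block_prob_error_outputs_ge[OF V c(2) C m_less])
  finally show ?thesis .
qed

lemma sum_isolated_prob_le:
  assumes C: "is_codebook n C" and rate: "2 powr (n * (r + 2 * \<delta>)) \<le> length C"
  defines "d \<equiv> CARD('x \<times> 'y)"
  shows "2 powr (n * (r + \<delta>)) * (\<Sum>m\<in>dominated C. isolated_prob C m)
    \<le> length C * (real ((n + d) ^ d) * 2 powr (- (n * \<delta>)))"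
proof -
  have "(\<Sum>m\<in>dominated C. isolated_prob C m) \<le> (\<Sum>m<length C. isolated_prob C m)"
    unfolding isolated_prob_def
    by (intro sum_mono2 block_prob_nonneg is_pmf_imp_is_channel_on is_pmf_output)
      (auto simp: dominated_messages_def)
  also have "\<dots> \<le> real ((n + d) ^ d)"
    using sum_block_prob_isolated_le[OF C is_pmf_output] unfolding isolated_prob_def d_def .
  finally have "2 powr (n * (r + \<delta>)) * (\<Sum>m\<in>dominated C. isolated_prob C m)
      \<le> 2 powr (n * (r + \<delta>)) * real ((n + d) ^ d)"
    by (intro mult_left_mono) auto
  also have "\<dots> = 2 powr (n * (r + 2 * \<delta>)) * (real ((n + d) ^ d) * 2 powr (- (n * \<delta>)))"
    by (simp add: algebra_simps flip: powr_add)
  also have "\<dots> \<le> length C * (real ((n + d) ^ d) * 2 powr (- (n * \<delta>)))"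
    using rate by (intro mult_right_mono) auto
  finally show ?thesis .
qed

lemma sum_error_prob_le_Pe:
  assumes C: "is_codebook n C"
  shows "(\<Sum>m\<in>dominated C. error_prob n C m) \<le> length C * Pe q (marg_Y V) n C"
proof -
  have "(\<Sum>m\<in>dominated C. error_prob n C m) \<le> (\<Sum>m<length C. error_prob n C m)"
    unfolding error_prob_def using is_channel_marg_Y[OF V]
    by (intro sum_mono2 block_prob_nonneg is_channel_imp_is_channel_on) (auto simp: dominated_messages_def)
  also have "\<dots> = length C * Pe q (marg_Y V) n C"
    using C by (simp add: Pe_eq_sum_block_prob[OF C] error_prob_def is_codebook_def)
  finally show ?thesis .
qed

lemma Pe_ge:
  assumes C: "is_codebook n C" and n: "0 < n" and rate: "2 powr (n * (r + 2 * \<delta>)) \<le> length C"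
  defines "d \<equiv> CARD('x \<times> 'y)"
  shows "c * ((1 - v / (n * \<delta>\<^sup>2)) * (card (dominated C) / length C)
      - real ((n + d) ^ d) * 2 powr (- (n * \<delta>))) \<le> Pe q (marg_Y V) n C"
proof -
  define M where "M = real (length C)"
  have "0 < M" using C by (simp add: M_def is_codebook_def)
  let ?poly = "real ((n + d) ^ d)"
  have "c * (card (dominated C) * (1 - v / (n * \<delta>\<^sup>2)) - M * (?poly * 2 powr (- (n * \<delta>))))
      \<le> c * (card (dominated C) * (1 - v / (n * \<delta>\<^sup>2))
          - 2 powr (n * (r + \<delta>)) * (\<Sum>m\<in>dominated C. isolated_prob C m))"
    using c(1) sum_isolated_prob_le[OF C rate] unfolding M_def d_def by (intro mult_left_mono) auto
  also have "\<dots> = (\<Sum>m\<in>dominated C.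
      c * (1 - (2 powr (n * (r + \<delta>)) * isolated_prob C m + v / (n * \<delta>\<^sup>2))))"
    by (simp only: sum_subtractf sum.distrib sum_constant sum_distrib_left[symmetric])
      (simp add: algebra_simps)
  also have "\<dots> \<le> (\<Sum>m\<in>dominated C. error_prob n C m)"
    by (intro sum_mono error_prob_ge C n)
  also have "\<dots> \<le> M * Pe q (marg_Y V) n C" unfolding M_def by (rule sum_error_prob_le_Pe[OF C])
  finally show ?thesis using \<open>0 < M\<close> unfolding M_def[symmetric] by (simp add: field_simps)
qed

lemma eventually_Pe_bounded_below_many_dominated:
  assumes N: "0 < N"
  shows "\<forall>\<^sub>F n in sequentially.
    Pe_bounded_below q (marg_Y V) (r + 2 * \<delta>) {C. many_dominated \<eta> P N C} (c / (2 * N)) n"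
proof -
  define d where "d = CARD('x \<times> 'y)"
  have variance: "(\<lambda>n. 1 - v / (n * \<delta>\<^sup>2)) \<longlonglongrightarrow> 1 - 0"
    using lim_const_over_n[of "v / \<delta>\<^sup>2"]
    by (intro tendsto_diff tendsto_const) (simp add: mult.commute)
  then have "\<forall>\<^sub>F n in sequentially. 0 < 1 - v / (n * \<delta>\<^sup>2)" by (intro order_tendstoD) auto
  moreover have "(\<lambda>n. (1 - v / (n * \<delta>\<^sup>2)) * (1 / N) - real ((n + d) ^ d) * 2 powr (- (n * \<delta>)))
      \<longlonglongrightarrow> (1 - 0) * (1 / N) - 0"
    by (intro tendsto_diff tendsto_mult tendsto_const variance
        polynomial_times_powr_minus_tendsto_0 \<delta>) (simp add: d_def)
  then have "\<forall>\<^sub>F n in sequentially. 1 / (2 * N)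
      < (1 - v / (n * \<delta>\<^sup>2)) * (1 / N) - real ((n + d) ^ d) * 2 powr (- (n * \<delta>))"
    by (rule order_tendstoD) (use N in \<open>simp add: field_simps\<close>)
  ultimately show ?thesis
    using eventually_gt_at_top[of 0] unfolding Pe_bounded_below_def
  proof (eventually_elim, intro ballI impI)
    case (elim n)
    fix C assume many: "C \<in> {C. many_dominated \<eta> P N C}"
      and C: "is_codebook n C" and rate: "2 powr (n * (r + 2 * \<delta>)) \<le> length C"
    have "0 < length C" using C by (simp add: is_codebook_def)
    moreover have "real (length C) \<le> card (dominated C) * N"
      using many by (simp add: many_dominated_def flip: of_nat_mult)
    ultimately have "1 / N \<le> card (dominated C) / length C" using N by (simp add: field_simps)
    then have "(1 - v / (n * \<delta>\<^sup>2)) * (1 / N)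
        \<le> (1 - v / (n * \<delta>\<^sup>2)) * (card (dominated C) / length C)"
      using elim(1) by (intro mult_left_mono) auto
    with elim(2) have "c * (1 / (2 * N))
        \<le> c * ((1 - v / (n * \<delta>\<^sup>2)) * (card (dominated C) / length C)
        - real ((n + d) ^ d) * 2 powr (- (n * \<delta>)))"
      using c(1) by (intro mult_left_mono) auto
    also have "\<dots> \<le> Pe q (marg_Y V) n C" unfolding d_def by (rule Pe_ge[OF C elim(3) rate])
    finally show "c / (2 * N) \<le> Pe q (marg_Y V) n C" by simp
  qed
qed

end

lemma ex_Pe_bounded_below_many_dominated:
  fixes W :: "'x::finite \<Rightarrow> 'y::finite \<Rightarrow> real" and \<delta> :: real
  assumes W: "is_channel W" and P: "is_pmf P" and P_pos: "\<And>x. 0 < P x"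
    and \<delta>: "0 < \<delta>" and \<eta>: "0 < \<eta>" "\<eta> * (CARD('x) / ln 2) \<le> \<delta>" and N: "0 < N"
  shows "\<exists>c>0. \<forall>\<^sub>F n in sequentially.
    Pe_bounded_below q W (Rbar W q + 4 * \<delta>) {C. many_dominated \<eta> P N C} c n"
proof -
  obtain V where V_Mmax: "V \<in> Mmax q P" and marg_Y: "marg_Y V = W"
    and info: "mutual_info P (marg_Yhat V) < Rbar W q + \<delta>"
    using ex_Mmax_mutual_info_less[OF W P, of q "Rbar W q + \<delta>"] \<delta> by auto
  have V_pmf: "is_cond_pmf2 V" using V_Mmax by (rule Mmax_imp_is_cond_pmf2)
  obtain c where c: "0 < c" "confusion_bound q V c"
    using Mmax_confusion_bound[OF V_Mmax P_pos] by blast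
  let ?Q = "output_pmf P (marg_Yhat V)"
  obtain v where v: "\<And>x z. (centred (marg_Yhat V) (log_ratio (marg_Yhat V) ?Q) x z)\<^sup>2 \<le> v"
    using finite_type_upper_bound[of
        "\<lambda>x z. (centred (marg_Yhat V) (log_ratio (marg_Yhat V) ?Q) x z)\<^sup>2"]
    by blast
  have "mutual_info P (marg_Yhat V) \<le> CARD('x) / ln 2"
    by (intro mutual_info_le P is_channel_marg_Yhat V_pmf)
  then have "\<eta> * mutual_info P (marg_Yhat V) \<le> \<eta> * (CARD('x) / ln 2)"
    using \<eta>(1) by (intro mult_left_mono) auto
  then have "(1 + \<eta>) * mutual_info P (marg_Yhat V) \<le> Rbar W q + 2 * \<delta>"
    using info \<eta>(2) by (simp add: distrib_right)
  then interpret dominating_pmf q V P c v "Rbar W q + 2 * \<delta>" \<delta> \<eta>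
    using V_pmf P P_pos c v \<delta> by unfold_locales
  have "Rbar W q + 2 * \<delta> + 2 * \<delta> = Rbar W q + 4 * \<delta>" by simp
  then have "\<forall>\<^sub>F n in sequentially.
      Pe_bounded_below q W (Rbar W q + 4 * \<delta>) {C. many_dominated \<eta> P N C} (c / (2 * N)) n"
    using eventually_Pe_bounded_below_many_dominated[OF N] by (simp only: marg_Y)
  then show ?thesis using c(1) N by (intro exI[of _ "c / (2 * N)"] conjI) simp_all
qed

lemma eventually_Pe_bounded_below:
  fixes W :: "'x::finite \<Rightarrow> 'y::finite \<Rightarrow> real"
  assumes W: "is_channel W" and R: "Rbar W q < R"
  obtains c where "0 < c" "\<forall>\<^sub>F n in sequentially. Pe_bounded_below q W R UNIV c n"
proof -
  define \<delta> where "\<delta> = (R - Rbar W q) / 4"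
  define \<eta> where "\<eta> = \<delta> * ln 2 / CARD('x)"
  have \<delta>: "0 < \<delta>" "R = Rbar W q + 4 * \<delta>" using R by (simp_all add: \<delta>_def field_simps)
  have \<eta>: "0 < \<eta>" "\<eta> * (CARD('x) / ln 2) \<le> \<delta>" using \<delta>(1) by (simp_all add: \<eta>_def)
  obtain F :: "('x \<Rightarrow> real) set" where F: "finite F" "\<And>P. P \<in> F \<Longrightarrow> is_pmf P"
      "\<And>P x. P \<in> F \<Longrightarrow> 0 < P x" and dom: "\<And>xs. \<exists>P\<in>F. dominated_by \<eta> P xs"
    using finite_dominating_pmfs[OF \<eta>(1)] by blast
  have "0 < card F" using F(1) dom by (auto simp: card_gt_0_iff)
  let ?many = "\<lambda>P. {C. many_dominated \<eta> P (card F) C}"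
  have "\<forall>P\<in>F. \<exists>c>0. \<forall>\<^sub>F n in sequentially. Pe_bounded_below q W R (?many P) c n"
    unfolding \<delta>(2)
    by (intro ballI ex_Pe_bounded_below_many_dominated W F(2,3) \<delta>(1) \<eta> \<open>0 < card F\<close>)
  from bchoice[OF this] obtain c where c: "\<And>P. P \<in> F \<Longrightarrow> 0 < c P"
    and bounded: "\<And>P. P \<in> F \<Longrightarrow> \<forall>\<^sub>F n in sequentially. Pe_bounded_below q W R (?many P) (c P) n"
    by blast
  obtain e where e: "0 < e" "\<And>P. P \<in> F \<Longrightarrow> e \<le> c P"
    using finite_positive_lower_bound[of F c] F(1) c by blast
  have "\<forall>\<^sub>F n in sequentially. \<forall>P\<in>F. Pe_bounded_below q W R (?many P) (c P) n"
    using bounded F(1) by (intro eventually_ball_finite) auto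
  then have "\<forall>\<^sub>F n in sequentially. Pe_bounded_below q W R UNIV e n"
  proof eventually_elim
    case (elim n)
    show ?case
      unfolding Pe_bounded_below_def
    proof (intro ballI impI)
      fix C :: "'x list list"
      assume "is_codebook n C" "2 powr (n * R) \<le> length C"
      moreover obtain P where P: "P \<in> F" "many_dominated \<eta> P (card F) C"
        using ex_many_dominated[OF F(1) dom, of C] by blast
      ultimately have "c P \<le> Pe q W n C" using elim by (simp add: Pe_bounded_below_def)
      with e(2)[OF P(1)] show "e \<le> Pe q W n C" by (rule order_trans)
    qed
  qed
  with e(1) show thesis by (rule that)
qed

lemma achievable_le_Rbar:
  fixes W :: "'x::finite \<Rightarrow> 'y::finite \<Rightarrow> real"
  assumes W: "is_channel W" and R: "achievable q W R"
  shows "R \<le> Rbar W q"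
proof (rule ccontr)
  assume "\<not> R \<le> Rbar W q"
  define \<epsilon> where "\<epsilon> = (R - Rbar W q) / 2"
  have \<epsilon>: "0 < \<epsilon>" "Rbar W q < R - \<epsilon>"
    using \<open>\<not> R \<le> Rbar W q\<close> by (auto simp: \<epsilon>_def field_simps)
  obtain Cs where Cs: "\<And>n. is_codebook n (Cs n)" "\<And>n. 2 powr (n * (R - \<epsilon>)) \<le> length (Cs n)"
    and lim: "liminf (\<lambda>n. ereal (Pe q W n (Cs n))) = 0"
    using R \<epsilon>(1) unfolding achievable_def by blast
  obtain c where c: "0 < c" and Pe: "\<forall>\<^sub>F n in sequentially. Pe_bounded_below q W (R - \<epsilon>) UNIV c n"
    using eventually_Pe_bounded_below[OF W \<epsilon>(2)] by blast
  from Pe have "\<forall>\<^sub>F n in sequentially. ereal c \<le> ereal (Pe q W n (Cs n))"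
    by eventually_elim (simp add: Cs Pe_bounded_below_def)
  then have "ereal c \<le> liminf (\<lambda>n. ereal (Pe q W n (Cs n)))" by (rule Liminf_bounded)
  then show False using lim c by simp
qed

theorem theorem1:
  fixes W :: "'x::finite \<Rightarrow> 'y::finite \<Rightarrow> real"
    and q :: "'x \<Rightarrow> 'y \<Rightarrow> real"
  assumes "is_channel W"
  shows "mismatch_capacity q W \<le> ereal (Rbar W q)"
  unfolding mismatch_capacity_def
proof (rule Sup_least)
  fix R assume "R \<in> ereal ` {R. achievable q W R}"
  then show "R \<le> ereal (Rbar W q)" using achievable_le_Rbar[OF assms] by auto
qed

end
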